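(* Let $d,a,b_1,\dots,b_n,c$ be positive integers with $d\mid q-1$, let $\lambda_1,\dots,\lambda_n\in\kappa^\times$ be distinct and different from $1$, and let $C_{D,\lambda}$ be the affine curve over $\kappa$ defined by $$y^d=\Big(\prod_{i=1}^n(1-\lambda_ix)^{b_i}\Big)x^a(1-x)^c,$$ with $\mu_d$ acting by $\xi\cdot(x,y)=(x,\xi y)$. Suppose that $\gcd(d,c)=\gcd(d,b_i)=1$ for all $i$. Then, for $m\in\mathbb{Z}/d\mathbb{Z}$, $$N_1(C_{D,\lambda};\chi^m)=\begin{cases}q&(m=0),\\ -j\big(\varphi_d^{ma},\varphi_d^{mc}\big)\,F_D^{(n)}\left({\varphi_d^{ma};\overline{\varphi_d}^{mb_1},\dots,\overline{\varphi_d}^{mb_n}\atop\varphi_d^{m(a+c)}};\lambda_1,\dots,\lambda_n\right)&(m\neq0).\end{cases}$$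
   Context: $\kappa$ is a finite field with $q$ elements of characteristic $p$. $\widehat{\kappa^\times}=\mathrm{Hom}(\kappa^\times,\overline{\mathbb{Q}}^\times)$ is the group of multiplicative characters, $\varepsilon$ the trivial character, $\overline{\eta}=\eta^{-1}$; every $\eta\in\widehat{\kappa^\times}$ (including $\varepsilon$) is extended to $\kappa$ by $\eta(0)=0$. $\delta(\eta)=1$ if $\eta=\varepsilon$ and $0$ otherwise. Fix a non-trivial additive character $\psi\in\mathrm{Hom}(\kappa,\overline{\mathbb{Q}}^\times)$. Put $$g(\eta)=-\sum_{x\in\kappa^\times}\psi(x)\eta(x),\quad g^\circ(\eta)=q^{\delta(\eta)}g(\eta),\quad j(\eta_1,\dots,\eta_k)=(-1)^{k-1}\sum_{x_i\in\kappa^\times,\ x_1+\cdots+x_k=1}\ \prod_{i=1}^k\eta_i(x_i)\ (k\ge 2),$$ $$(\alpha)_\nu=\frac{g(\alpha\nu)}{g(\alpha)},\qquad(\alpha)_\nu^\circ=\frac{g^\circ(\alpha\nu)}{g^\circ(\alpha)},$$ $$F_D^{(n)}\left({\alpha;\beta_1,\dots,\beta_n\atop\gamma};\lambda_1,\dots,\lambda_n\right)=\frac{1}{(1-q)^n}\sum_{\nu_1,\dots,\nu_n\in\widehat{\kappa^\times}}\frac{(\alpha)_{\nu_1\cdots\nu_n}(\beta_1)_{\nu_1}\cdots(\beta_n)_{\nu_n}}{(\gamma)^\circ_{\nu_1\cdots\nu_n}(\varepsilon)^\circ_{\nu_1}\cdots(\varepsilon)^\circ_{\nu_n}}\nu_1(\lambda_1)\cdots\nu_n(\lambda_n).$$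 $\mu_d\subset\kappa^\times$ is the group of $d$th roots of unity. Fix a generator $\varphi$ of $\widehat{\kappa^\times}$ and put $\varphi_d=\varphi^{(q-1)/d}$, $\chi=\varphi|_{\mu_d}$, so that $\widehat{\mu_d}=\{\chi^m\mid m\in\mathbb{Z}/d\mathbb{Z}\}$. For a variety $V$ over $\kappa$ with an action over $\kappa$ of a finite abelian group $G$, with $F$ the $q$-Frobenius on $V(\overline{\kappa})$, and for $\theta\in\mathrm{Hom}(G,\overline{\mathbb{Q}}^\times)$ and $r\ge1$, $$N_r(V;\theta)=\frac{1}{\#G}\sum_{g\in G}\theta(g)\,\#\{x\in V(\overline{\kappa})\mid F^r(x)=g(x)\}.$$ *)

theory Defs
  imports "HOL-Algebra.Algebraic_Closure_Type" "HOL-Library.FuncSet" "HOL-Library.Cardinality"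
begin

(* The finite field kappa is a type 'k :: {field, finite}, with q = CARD('k). *)

type_synonym qbar = "rat alg_closure"

subsection \<open>Characters\<close>

(* The multiplicative characters of kappa, each extended to kappa by the value 0 at 0; in
   particular the trivial character takes the value 0 at 0. *)
definition mult_char_group :: "('k :: {field, finite} \<Rightarrow> qbar) monoid" where
  "mult_char_group =
     \<lparr>carrier = {\<eta>. \<eta> 0 = 0 \<and> (\<forall>x. x \<noteq> 0 \<longrightarrow> \<eta> x \<noteq> 0) \<and>
                   (\<forall>x y. x \<noteq> 0 \<longrightarrow> y \<noteq> 0 \<longrightarrow> \<eta> (x * y) = \<eta> x * \<eta> y)},
      monoid.mult = (\<lambda>\<eta> \<theta> x. \<eta> x * \<theta> x),
      one = (\<lambda>x. if x = 0 then 0 else 1)\<rparr>"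

abbreviation char_grp :: "('k :: {field, finite} \<Rightarrow> qbar) monoid"  (\<open>\<X>\<close>)
  where "\<X> \<equiv> mult_char_group"

lemma comm_group_mult_char_group: "comm_group (\<X> :: ('k :: {field, finite} \<Rightarrow> qbar) monoid)"
proof (rule comm_groupI)
  fix \<eta> :: "'k \<Rightarrow> qbar"
  assume "\<eta> \<in> carrier \<X>"
  then show "\<exists>\<theta>\<in>carrier \<X>. \<theta> \<otimes>\<^bsub>\<X>\<^esub> \<eta> = \<one>\<^bsub>\<X>\<^esub>"
    by (intro bexI[of _ "\<lambda>x. inverse (\<eta> x)"]) (auto simp: mult_char_group_def)
qed (auto simp: mult_char_group_def mult_ac)

definition nontrivial_add_char :: "('k :: {field, finite} \<Rightarrow> qbar) \<Rightarrow> bool" where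
  "nontrivial_add_char \<psi> \<longleftrightarrow>
     (\<forall>x. \<psi> x \<noteq> 0) \<and> (\<forall>x y. \<psi> (x + y) = \<psi> x * \<psi> y) \<and> (\<exists>x. \<psi> x \<noteq> 1)"

subsection \<open>Gauss and Jacobi sums, Pochhammer symbols, the Lauricella function\<close>

definition gauss_sum :: "('k :: {field, finite} \<Rightarrow> qbar) \<Rightarrow> ('k \<Rightarrow> qbar) \<Rightarrow> qbar" where
  "gauss_sum \<psi> \<eta> = - (\<Sum>x\<in>UNIV - {0}. \<psi> x * \<eta> x)"

definition gauss_sum0 :: "('k :: {field, finite} \<Rightarrow> qbar) \<Rightarrow> ('k \<Rightarrow> qbar) \<Rightarrow> qbar" where
  "gauss_sum0 \<psi> \<eta> = of_nat CARD('k) ^ (if \<eta> = \<one>\<^bsub>\<X>\<^esub> then 1 else 0) * gauss_sum \<psi> \<eta>"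

definition jacobi_sum :: "('k :: {field, finite} \<Rightarrow> qbar) list \<Rightarrow> qbar" where
  "jacobi_sum \<eta>s = (- 1) ^ (length \<eta>s - 1) *
     (\<Sum>xs | set xs \<subseteq> UNIV - {0} \<and> length xs = length \<eta>s \<and> sum_list xs = 1.
        \<Prod>i<length \<eta>s. (\<eta>s ! i) (xs ! i))"

definition poch ::
  "('k :: {field, finite} \<Rightarrow> qbar) \<Rightarrow> ('k \<Rightarrow> qbar) \<Rightarrow> ('k \<Rightarrow> qbar) \<Rightarrow> qbar" where
  "poch \<psi> \<alpha> \<nu> = gauss_sum \<psi> (\<alpha> \<otimes>\<^bsub>\<X>\<^esub> \<nu>) / gauss_sum \<psi> \<alpha>"

definition poch0 ::
  "('k :: {field, finite} \<Rightarrow> qbar) \<Rightarrow> ('k \<Rightarrow> qbar) \<Rightarrow> ('k \<Rightarrow> qbar) \<Rightarrow> qbar" where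
  "poch0 \<psi> \<alpha> \<nu> = gauss_sum0 \<psi> (\<alpha> \<otimes>\<^bsub>\<X>\<^esub> \<nu>) / gauss_sum0 \<psi> \<alpha>"

(* Only the entries of beta and lambda at the indices 1, ..., n are used. *)
definition lauricella_FD ::
  "('k :: {field, finite} \<Rightarrow> qbar) \<Rightarrow> nat \<Rightarrow> ('k \<Rightarrow> qbar) \<Rightarrow> (nat \<Rightarrow> 'k \<Rightarrow> qbar) \<Rightarrow>
     ('k \<Rightarrow> qbar) \<Rightarrow> (nat \<Rightarrow> 'k) \<Rightarrow> qbar" where
  "lauricella_FD \<psi> n \<alpha> \<beta> \<gamma> lam =
     1 / (1 - of_nat CARD('k)) ^ n *
     (\<Sum>\<nu> \<in> {1..n} \<rightarrow>\<^sub>E carrier \<X>.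
        (poch \<psi> \<alpha> (finprod \<X> \<nu> {1..n}) * (\<Prod>i=1..n. poch \<psi> (\<beta> i) (\<nu> i))) /
        (poch0 \<psi> \<gamma> (finprod \<X> \<nu> {1..n}) * (\<Prod>i=1..n. poch0 \<psi> \<one>\<^bsub>\<X>\<^esub> (\<nu> i))) *
        (\<Prod>i=1..n. \<nu> i (lam i)))"

subsection \<open>Point counts twisted by a character\<close>

(* V is the set of geometric points, F the q-Frobenius on it, and act the action of the finite
   abelian group with underlying set G; theta is only evaluated on G. *)
definition twisted_count ::
  "'p set \<Rightarrow> ('p \<Rightarrow> 'p) \<Rightarrow> 'g set \<Rightarrow> ('g \<Rightarrow> 'p \<Rightarrow> 'p) \<Rightarrow> nat \<Rightarrow> ('g \<Rightarrow> qbar) \<Rightarrow> qbar" where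
  "twisted_count V F G act r \<theta> =
     1 / of_nat (card G) * (\<Sum>g\<in>G. \<theta> g * of_nat (card {x \<in> V. (F ^^ r) x = act g x}))"

definition frob_plane ::
  "('k :: {field, finite}) alg_closure \<times> 'k alg_closure \<Rightarrow> 'k alg_closure \<times> 'k alg_closure" where
  "frob_plane = (\<lambda>(x, y). (x ^ CARD('k), y ^ CARD('k)))"

definition mu :: "nat \<Rightarrow> ('k :: {field, finite}) set" where
  "mu d = {\<xi>. \<xi> ^ d = 1}"

definition mu_act ::
  "'k :: {field, finite} \<Rightarrow> 'k alg_closure \<times> 'k alg_closure \<Rightarrow> 'k alg_closure \<times> 'k alg_closure" where
  "mu_act \<xi> = (\<lambda>(x, y). (x, to_ac \<xi> * y))"

definition curve_CD ::
  "nat \<Rightarrow> nat \<Rightarrow> nat \<Rightarrow> (nat \<Rightarrow> nat) \<Rightarrow> nat \<Rightarrow> (nat \<Rightarrow> 'k :: {field, finite}) \<Rightarrow>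
     ('k alg_closure \<times> 'k alg_closure) set" where
  "curve_CD n d a b c lam =
     {(x, y). y ^ d = (\<Prod>i=1..n. (1 - to_ac (lam i) * x) ^ b i) * x ^ a * (1 - x) ^ c}"

(* phi_d = phi^((q-1)/d); the division is exact when d divides q - 1. *)
definition char_root :: "('k :: {field, finite} \<Rightarrow> qbar) \<Rightarrow> nat \<Rightarrow> 'k \<Rightarrow> qbar" where
  "char_root \<phi> d = \<phi> [^]\<^bsub>\<X>\<^esub> ((CARD('k) - 1) div d)"

definition char_mu :: "('k :: {field, finite} \<Rightarrow> qbar) \<Rightarrow> nat \<Rightarrow> 'k \<Rightarrow> qbar" where
  "char_mu \<phi> d = restrict \<phi> (mu d)"

end

theory Submission
  imports Defs
begin

text \<open>
  Write \<open>q\<close> for the number of elements of \<open>\<kappa>\<close>, \<open>f(x)\<close> for the right-hand side of the equation of the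
  curve and \<open>\<rho>\<close> for the character \<open>\<phi>\<^sub>d\<close>.  A geometric point \<open>(x, y)\<close> with Frobenius image \<open>(x, \<xi> y)\<close> has
  \<open>x\<close> in \<open>\<kappa>\<close>.  If \<open>f(x) = 0\<close>, then \<open>y = 0\<close> and the point is counted for every \<open>\<xi>\<close>; if \<open>f(x) \<noteq> 0\<close>, then
  \<open>y^(q-1)\<close> is \<open>f(x)^((q-1)/d)\<close>, so that all \<open>d\<close> points over \<open>x\<close> are counted for this single \<open>\<xi>\<close>.
  Averaging against \<open>\<chi>^m\<close> turns the count into the sum of \<open>\<rho>(f(x))^m\<close> over the \<open>x\<close> with \<open>f(x) \<noteq> 0\<close>, to
  which the zeros of \<open>f\<close> add one each exactly when \<open>d\<close> divides \<open>m\<close>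
  (\<open>twisted_count_superelliptic\<close>, \<open>sum_char_mu\<close>).  If \<open>d\<close> divides \<open>m\<close>, every term is 1 and the total
  is \<open>q\<close>.
  
  Otherwise the sum is a finite-field analogue of Euler's integral
  \<open>\<integral> x^(\<alpha>-1) (1-x)^(\<gamma>-\<alpha>-1) \<Prod>\<^sub>i (1 - \<lambda>\<^sub>i x)^(-\<beta>\<^sub>i) dx\<close>, and it is evaluated in the same way
  (\<open>lauricella_FD_integral\<close>).  Each factor \<open>1 - \<lambda>\<^sub>i x\<close> is expanded by a binomial theorem over the
  character group (\<open>binomial_theorem_char\<close>), whose coefficients are the quotients
  \<open>(\<beta>\<^sub>i)\<^sub>\<nu> / (\<epsilon>)\<degree>\<^sub>\<nu>\<close>.  The remaining sum over \<open>x\<close> is a Jacobi sum \<open>j(\<alpha>\<nu>, \<chi>)\<close>, and the relation between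
  Jacobi and Gauss sums (\<open>gauss_sum_mult\<close>) writes it as \<open>j(\<alpha>, \<chi>)\<close> times \<open>(\<alpha>)\<^sub>\<nu> / (\<alpha>\<chi>)\<degree>\<^sub>\<nu>\<close>
  (\<open>jacobi_sum_mult_char\<close>).  Both steps need \<open>\<beta>\<^sub>i\<close> and \<open>\<chi>\<close> to be nontrivial; this is where \<open>gcd(d, b\<^sub>i) = 1\<close>
  and \<open>gcd(d, c) = 1\<close> enter.  The character \<open>\<alpha>\<close> and the product \<open>\<alpha>\<chi>\<close> may be trivial, and the factor
  \<open>q^\<delta>\<close> in \<open>g\<degree>\<close> is what keeps the formulas uniform in these cases.
  
  The binomial theorem rests on the orthogonality relation for the characters evaluated at a fixed
  element (\<open>sum_char_group\<close>).  It requires enough characters to separate points, which come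
  from the cyclicity of \<open>\<kappa>\<^sup>\<times>\<close> and from the roots of unity in the algebraic closure of \<open>\<rat>\<close>
  (\<open>char_separates\<close>).
\<close>
section \<open>Powers and roots in fields\<close>

lemma power_mod_exponent:
  fixes z :: "'a :: monoid_mult"
  assumes "z ^ n = 1"
  shows "z ^ (i mod n) = z ^ i"
proof -
  have "z ^ i = z ^ (n * (i div n) + i mod n)" by simp
  also have "\<dots> = z ^ (i mod n)" by (simp only: power_add power_mult assms) simp
  finally show ?thesis by simp
qed

lemma power_int_prod: "(\<Prod>i\<in>A. f i :: 'a :: field) powi m = (\<Prod>i\<in>A. f i powi m)"
  by (induction A rule: infinite_finite_induct) (simp_all add: power_int_mult_distrib)

lemma finite_nth_roots_idom:
  fixes t :: "'a :: idom"
  assumes "n > 0"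
  shows "finite {z. z ^ n = t}"
proof -
  define p where "p = monom 1 n + [:- t:]"
  have "degree p = n"
    unfolding p_def using assms by (subst degree_add_eq_left) (auto simp: degree_monom_eq)
  then have "p \<noteq> 0" using assms by auto
  moreover have "{z. z ^ n = t} = {z. poly p z = 0}"
    by (auto simp: p_def poly_monom)
  ultimately show ?thesis by (simp add: poly_roots_finite)
qed

text \<open>
  The polynomial \<open>X^d - t\<close> splits into linear factors, and they are distinct because the derivative
  \<open>d X^(d-1)\<close> vanishes only at 0, which is not a root.
\<close>
lemma card_nth_roots_alg_closed:
  fixes t :: "'a :: alg_closed_field"
  assumes "of_nat d \<noteq> (0 :: 'a)" and "t \<noteq> 0"
  shows "card {y. y ^ d = t} = d"
proof -
  have d: "d > 0" using assms(1) by (cases d) auto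
  define p where "p = monom 1 d + [:- t:]"
  have deg: "degree p = d"
    unfolding p_def using d by (subst degree_add_eq_left) (auto simp: degree_monom_eq)
  have "p \<noteq> 0" using deg d by auto
  then obtain A c where A: "size A = degree p" "p = smult c (\<Prod>x\<in>#A. [:-x, 1:])"
    using alg_closed_imp_factorization by metis
  have c: "c \<noteq> 0" using A(2) \<open>p \<noteq> 0\<close> by auto
  have roots: "{y. y ^ d = t} = {y. poly p y = 0}"
    by (auto simp: p_def poly_monom)
  have roots': "{y. poly p y = 0} = set_mset A"
    using c by (subst A(2)) (auto simp: poly_prod_mset)
  have "count A x = 1" if "x \<in># A" for x
  proof (rule ccontr)
    assume "count A x \<noteq> 1"
    then have "x \<in># A - {#x#}" using that
      by (metis Suc_lessI count_greater_zero_iff in_diff_count count_single One_nat_def)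
    then have B: "A = add_mset x (add_mset x (A - {#x#} - {#x#}))"
      using that by (simp only: insert_DiffM)
    define B where "B = A - {#x#} - {#x#}"
    note B = B[folded B_def]
    have split: "(\<Prod>y\<in>#A. [:-y, 1:]) = [:-x, 1:] * ([:-x, 1:] * (\<Prod>y\<in>#B. [:-y, 1:]))"
      unfolding B by (simp only: image_mset_add_mset prod_mset.add_mset)
    have double: "p = [:-x, 1:] * ([:-x, 1:] * smult c (\<Prod>y\<in>#B. [:-y, 1:]))"
      unfolding A(2) split mult_smult_right ..
    have "poly (pderiv p) x = 0"
      unfolding double pderiv_mult poly_add poly_mult by simp
    moreover have "pderiv p = monom (of_nat d) (d - 1)"
      by (simp add: p_def pderiv_add pderiv_monom pderiv_pCons)
    ultimately have "x ^ (d - 1) = 0"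
      using assms(1) by (simp add: poly_monom)
    then have "x = 0" by simp
    moreover have "x ^ d = t" using that roots roots' by blast
    ultimately show False using d assms(2) by (simp add: power_0_left)
  qed
  \<comment> \<open>Since no root is repeated, the number of linear factors is the number of roots.\<close>
  then have "size A = card (set_mset A)"
    by (simp add: size_multiset_overloaded_eq)
  then show ?thesis using roots roots' A(1) deg by simp
qed

section \<open>Finite fields\<close>

lemma card_field_ge_2: "CARD('k :: {field, finite}) \<ge> 2"
  using card_mono[of UNIV "{0, 1 :: 'k}"] by simp

lemma finite_field_power_card_minus_1:
  fixes x :: "'k :: {field, finite}"
  assumes "x \<noteq> 0"
  shows "x ^ (CARD('k) - 1) = 1"
proof -
  \<comment> \<open>Multiplication by \<open>x\<close> permutes the nonzero elements, so it does not change their product.\<close>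
  have "(\<Prod>y\<in>UNIV - {0}. x * y) = (\<Prod>y\<in>UNIV - {0}. y)"
    by (rule prod.reindex_bij_witness[of _ "\<lambda>y. y / x" "\<lambda>y. x * y"]) (use assms in auto)
  then show ?thesis
    by (simp add: prod.distrib)
qed

lemma finite_field_power_card:
  fixes x :: "'k :: {field, finite}"
  shows "x ^ CARD('k) = x"
proof -
  have "x ^ CARD('k) = x * x ^ (CARD('k) - 1)"
    using card_field_ge_2[where 'k = 'k] by (simp flip: power_Suc)
  then show ?thesis
    using finite_field_power_card_minus_1[of x] by (cases "x = 0") auto
qed

lemma of_nat_card_finite_field: "of_nat CARD('k) = (0 :: 'k :: {field, finite})"
proof -
  \<comment> \<open>Adding 1 permutes the field, so it does not change the sum of all elements.\<close>
  have "(\<Sum>x\<in>UNIV. x + 1) = (\<Sum>x\<in>UNIV. x :: 'k)"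
    by (rule sum.reindex_bij_witness[of _ "\<lambda>x. x - 1" "\<lambda>x. x + 1"]) auto
  then show ?thesis
    by (simp add: sum.distrib)
qed

text \<open>
  As \<open>q - 1\<close> is \<open>-1\<close> in the field, none of its divisors vanishes there; this makes the roots of
  \<open>X^d - t\<close> distinct for every \<open>d\<close> dividing \<open>q - 1\<close>.
\<close>
lemma of_nat_dvd_card_minus_1:
  assumes "d dvd CARD('k :: {field, finite}) - 1"
  shows "of_nat d \<noteq> (0 :: 'k)"
proof
  assume "of_nat d = (0 :: 'k)"
  then have "of_nat (CARD('k) - 1) = (0 :: 'k)"
    using assms by (metis dvdE mult_zero_left of_nat_mult)
  moreover have "of_nat (CARD('k) - 1) = (- 1 :: 'k)"
    using card_field_ge_2[where 'k = 'k] by (simp add: of_nat_diff of_nat_card_finite_field)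
  ultimately show False by simp
qed

text \<open>
  The polynomial \<open>X^q - X\<close> has at most \<open>q\<close> roots, and the elements of the field already provide \<open>q\<close>
  of them.
\<close>
lemma fixed_by_frobenius_iff:
  fixes y :: "'k :: {field, finite} alg_closure"
  shows "y ^ CARD('k) = y \<longleftrightarrow> y \<in> range to_ac"
proof -
  define p :: "'k alg_closure poly" where "p = monom 1 CARD('k) + [:0, - 1:]"
  have deg: "degree p = CARD('k)"
    unfolding p_def using card_field_ge_2[where 'k = 'k]
    by (subst degree_add_eq_left) (auto simp: degree_monom_eq)
  have "p \<noteq> 0" using deg by auto
  have roots: "{y. poly p y = 0} = {y. y ^ CARD('k) = y}"
    by (auto simp: p_def poly_monom)
  have fin: "finite {y :: 'k alg_closure. y ^ CARD('k) = y}"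
    using poly_roots_finite[OF \<open>p \<noteq> 0\<close>] roots by simp
  have "card {y :: 'k alg_closure. y ^ CARD('k) = y} \<le> CARD('k)"
    using card_poly_roots_bound[OF \<open>p \<noteq> 0\<close>] roots deg by simp
  moreover have "card (range (to_ac :: 'k \<Rightarrow> _)) = CARD('k)"
    by (intro card_image) (auto intro: injI)
  moreover have "range (to_ac :: 'k \<Rightarrow> _) \<subseteq> {y. y ^ CARD('k) = y}"
    by (auto simp: finite_field_power_card simp flip: to_ac_power)
  ultimately have "range (to_ac :: 'k \<Rightarrow> _) = {y. y ^ CARD('k) = y}"
    using fin card_seteq by metis
  then show ?thesis by auto
qed

lemma nth_root_unity_alg_closure_in_range:
  fixes y :: "'k :: {field, finite} alg_closure"
  assumes "d dvd CARD('k) - 1" and "y ^ d = 1"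
  shows "y \<in> range to_ac"
proof -
  obtain e where e: "CARD('k) - 1 = d * e" using assms(1) by blast
  have "y ^ CARD('k) = y * y ^ (CARD('k) - 1)"
    using card_field_ge_2[where 'k = 'k] by (simp flip: power_Suc)
  also have "\<dots> = y" by (simp only: e power_mult assms(2)) simp
  finally show ?thesis by (simp add: fixed_by_frobenius_iff)
qed

text \<open>
  All \<open>d\<close> roots of \<open>X^d - 1\<close> in the algebraic closure are fixed by Frobenius, hence lie in the field.
\<close>
lemma card_mu:
  assumes "d dvd CARD('k :: {field, finite}) - 1"
  shows "card (mu d :: 'k set) = d"
proof -
  have "to_ac ` (mu d :: 'k set) = {y. y ^ d = 1}"
    using nth_root_unity_alg_closure_in_range[OF assms]
    by (auto simp: mu_def image_iff simp flip: to_ac_power) (metis rangeE to_ac_1 to_ac_eq_iff to_ac_power)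
  moreover have "card (to_ac ` (mu d :: 'k set)) = card (mu d :: 'k set)"
    by (intro card_image) (auto intro: inj_onI)
  moreover have "of_nat d \<noteq> (0 :: 'k alg_closure)"
    using of_nat_dvd_card_minus_1[OF assms] by (metis to_ac_eq_0_iff to_ac_of_nat)
  ultimately show ?thesis
    using card_nth_roots_alg_closed[of d "1 :: 'k alg_closure"] by simp
qed

text \<open>
  The cyclicity of the multiplicative group, transferred from the record-based field to the type
  class.
\<close>
lemma ex_generator_units_finite_field:
  "\<exists>g :: 'k :: {field, finite}. g \<noteq> 0 \<and> (\<forall>x. x \<noteq> 0 \<longrightarrow> (\<exists>i. x = g ^ i))"
proof -
  let ?R = "ring_of_type_algebra :: 'k ring"
  have R: "field ?R" by (rule field_from_type_algebra)
  have pow: "x [^]\<^bsub>?R\<^esub> (i :: nat) = x ^ i" for x :: 'k and i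
    by (induction i) (simp_all add: ring_of_type_algebra_def power_commutes)
  have carr: "carrier (Multiplicative_Group.mult_of ?R) = UNIV - {0 :: 'k}"
    by (simp add: Multiplicative_Group.carrier_mult_of) (simp add: ring_of_type_algebra_def)
  have "\<exists>g\<in>UNIV - {0 :: 'k}. UNIV - {0} = {g ^ i | i :: nat. i \<in> UNIV}"
    using field.finite_field_mult_group_has_gen[OF R]
    unfolding carr pow by simp
  then obtain g :: 'k where "g \<in> UNIV - {0 :: 'k}" and gen: "UNIV - {0} = {g ^ i | i :: nat. i \<in> UNIV}"
    by (rule bexE)
  from this(1) have "g \<noteq> 0" by simp
  moreover have "\<exists>i. x = g ^ i" if "x \<noteq> 0" for x
  proof -
    have "x \<in> UNIV - {0}" using that by simp
    then show ?thesis unfolding gen by simp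
  qed
  ultimately show ?thesis by (intro exI[of _ g]) simp
qed

lemma cyclic_units_finite_field:
  obtains g :: "'k :: {field, finite}"
  where "g \<noteq> 0" "\<And>x. x \<noteq> 0 \<Longrightarrow> \<exists>i. x = g ^ i" "\<And>k. g ^ k = 1 \<longleftrightarrow> CARD('k) - 1 dvd k"
proof -
  obtain g :: 'k where g: "g \<noteq> 0" and ex: "\<And>x. x \<noteq> 0 \<Longrightarrow> \<exists>i. x = g ^ i"
    using ex_generator_units_finite_field by metis
  have q: "CARD('k) - 1 > 0" using card_field_ge_2[where 'k = 'k] by simp
  \<comment> \<open>If \<open>g\<close> had order less than \<open>q - 1\<close>, its powers could not exhaust the nonzero elements.\<close>
  have pos: "k = 0" if k: "g ^ k = 1" "k < CARD('k) - 1" for k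
  proof (rule ccontr)
    assume "k \<noteq> 0"
    have "UNIV - {0} \<subseteq> (\<lambda>i. g ^ i) ` {..<k}"
    proof
      fix x assume "x \<in> UNIV - {0 :: 'k}"
      then obtain i where "x = g ^ i" using ex by auto
      then have "x = g ^ (i mod k)" using power_mod_exponent[OF k(1)] by metis
      then show "x \<in> (\<lambda>i. g ^ i) ` {..<k}" using \<open>k \<noteq> 0\<close> by (intro image_eqI[of _ _ "i mod k"]) auto
    qed
    then have "card (UNIV - {0 :: 'k}) \<le> card ((\<lambda>i. g ^ i) ` {..<k})"
      by (intro card_mono) auto
    also have "\<dots> \<le> k"
      using card_image_le[of "{..<k}" "\<lambda>i. g ^ i"] by simp
    finally have "card (UNIV - {0 :: 'k}) \<le> k" .
    then show False using k(2) by (simp add: card_Diff_subset)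
  qed
  have ord: "g ^ k = 1 \<longleftrightarrow> CARD('k) - 1 dvd k" for k
  proof
    assume "g ^ k = 1"
    then have "g ^ (k mod (CARD('k) - 1)) = 1"
      using power_mod_exponent[OF finite_field_power_card_minus_1[OF g], of k] by metis
    then show "CARD('k) - 1 dvd k"
      using pos q by (metis dvd_eq_mod_eq_0 mod_less_divisor)
  next
    assume "CARD('k) - 1 dvd k"
    then show "g ^ k = 1"
      using finite_field_power_card_minus_1[OF g] by (metis dvd_def power_mult power_one)
  qed
  show ?thesis using that[OF g ex ord] .
qed

section \<open>Multiplicative characters\<close>

text \<open>
  Because a character takes the value 0 at 0, the rules for products, inverses and powers below hold
  without side conditions on the arguments.
\<close>
lemma char_iff:
  "\<eta> \<in> carrier \<X> \<longleftrightarrow> \<eta> 0 = 0 \<and> (\<forall>x. x \<noteq> 0 \<longrightarrow> \<eta> x \<noteq> 0) \<and>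
     (\<forall>x y. x \<noteq> 0 \<longrightarrow> y \<noteq> 0 \<longrightarrow> \<eta> (x * y) = \<eta> x * \<eta> y)"
  by (simp add: mult_char_group_def)

lemma char_zero: "\<eta> \<in> carrier \<X> \<Longrightarrow> \<eta> 0 = 0"
  unfolding char_iff by (elim conjE)

lemma char_eq_0_iff: "\<eta> \<in> carrier \<X> \<Longrightarrow> \<eta> x = 0 \<longleftrightarrow> x = 0"
  unfolding char_iff by metis

lemma char_mult:
  assumes "\<eta> \<in> carrier \<X>" shows "\<eta> (x * y) = \<eta> x * \<eta> y"
proof (cases "x = 0 \<or> y = 0")
  case True
  then show ?thesis using char_zero[OF assms] by auto
next
  case False
  then show ?thesis using assms unfolding char_iff by blast
qed

lemma char_one:
  assumes "\<eta> \<in> carrier \<X>"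
  shows "\<eta> 1 = 1"
proof -
  have "\<eta> 1 * \<eta> 1 = \<eta> 1 * 1" by (simp flip: char_mult[OF assms])
  then show ?thesis unfolding mult_cancel_left by (simp add: char_eq_0_iff[OF assms])
qed

lemma char_inverse:
  assumes "\<eta> \<in> carrier \<X>"
  shows "\<eta> (inverse x) = inverse (\<eta> x)"
proof (cases "x = 0")
  case True
  then show ?thesis by (simp add: char_zero[OF assms])
next
  case False
  then have "\<eta> x * \<eta> (inverse x) = 1"
    by (simp add: char_one[OF assms] flip: char_mult[OF assms])
  then show ?thesis by (rule inverse_unique[symmetric])
qed

lemma char_power:
  assumes "\<eta> \<in> carrier \<X>"
  shows "\<eta> (x ^ k) = \<eta> x ^ k"
  by (induction k) (simp_all add: char_mult[OF assms] char_one[OF assms])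

lemma char_prod:
  assumes "\<eta> \<in> carrier \<X>"
  shows "\<eta> (\<Prod>i\<in>A. f i) = (\<Prod>i\<in>A. \<eta> (f i))"
  by (induction A rule: infinite_finite_induct) (simp_all add: char_one[OF assms] char_mult[OF assms])

lemma mult_char_apply: "(\<eta> \<otimes>\<^bsub>\<X>\<^esub> \<theta>) x = \<eta> x * \<theta> x"
  by (simp add: mult_char_group_def)

lemma one_char_apply: "\<one>\<^bsub>\<X>\<^esub> x = (if x = 0 then 0 else 1)"
  by (simp add: mult_char_group_def)

lemma group_char: "group (\<X> :: ('k :: {field, finite} \<Rightarrow> qbar) monoid)"
  by (rule comm_group.axioms(2)[OF comm_group_mult_char_group])

lemma one_char_closed [simp]: "\<one>\<^bsub>\<X>\<^esub> \<in> carrier \<X>"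
  by (rule monoid.one_closed[OF group.is_monoid[OF group_char]])

lemma mult_char_closed [simp]:
  "\<eta> \<in> carrier \<X> \<Longrightarrow> \<theta> \<in> carrier \<X> \<Longrightarrow> \<eta> \<otimes>\<^bsub>\<X>\<^esub> \<theta> \<in> carrier \<X>"
  by (rule monoid.m_closed[OF group.is_monoid[OF group_char]])

lemma inv_char_closed [simp]: "\<eta> \<in> carrier \<X> \<Longrightarrow> inv\<^bsub>\<X>\<^esub> \<eta> \<in> carrier \<X>"
  by (rule group.inv_closed[OF group_char])

lemma inv_char_apply:
  assumes "\<eta> \<in> carrier \<X>"
  shows "(inv\<^bsub>\<X>\<^esub> \<eta>) x = inverse (\<eta> x)"
proof (cases "x = 0")
  case True
  then show ?thesis by (simp add: char_zero[OF assms] char_zero[OF inv_char_closed[OF assms]])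
next
  case False
  have "\<eta> \<otimes>\<^bsub>\<X>\<^esub> inv\<^bsub>\<X>\<^esub> \<eta> = \<one>\<^bsub>\<X>\<^esub>"
    using assms by (rule group.r_inv[OF group_char])
  then have "(\<eta> \<otimes>\<^bsub>\<X>\<^esub> inv\<^bsub>\<X>\<^esub> \<eta>) x = 1"
    using False by (simp add: one_char_apply)
  then show ?thesis unfolding mult_char_apply by (rule inverse_unique[symmetric])
qed

text \<open>
  Products and powers of characters are pointwise away from 0.  At 0 this fails for the empty product
  and for the zeroth power, which are the trivial character and vanish there.
\<close>
lemma finprod_char_apply:
  fixes \<nu> :: "nat \<Rightarrow> 'k :: {field, finite} \<Rightarrow> qbar"
  assumes "finite A" and "\<And>i. i \<in> A \<Longrightarrow> \<nu> i \<in> carrier \<X>" and "x \<noteq> 0"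
  shows "finprod \<X> \<nu> A x = (\<Prod>i\<in>A. \<nu> i x)"
proof -
  interpret comm_group "\<X> :: ('k \<Rightarrow> qbar) monoid" by (rule comm_group_mult_char_group)
  show ?thesis
    using assms(1,2)
  proof (induction A rule: finite_induct)
    case (insert i A)
    then have "finprod \<X> \<nu> (insert i A) = \<nu> i \<otimes>\<^bsub>\<X>\<^esub> finprod \<X> \<nu> A"
      by (intro finprod_insert) auto
    then show ?case using insert by (simp add: mult_char_apply)
  qed (simp add: one_char_apply assms(3))
qed

lemma nat_pow_char_apply:
  fixes \<eta> :: "'k :: {field, finite} \<Rightarrow> qbar" and k :: nat
  assumes "x \<noteq> 0"
  shows "(\<eta> [^]\<^bsub>\<X>\<^esub> k) x = \<eta> x ^ k"
proof -
  interpret group "\<X> :: ('k \<Rightarrow> qbar) monoid" by (rule group_char)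
  show ?thesis using assms
    by (induction k) (simp_all add: one_char_apply mult_char_apply)
qed

lemma int_pow_char_apply:
  fixes \<eta> :: "'k :: {field, finite} \<Rightarrow> qbar" and k :: int
  assumes "\<eta> \<in> carrier \<X>" and "x \<noteq> 0"
  shows "(\<eta> [^]\<^bsub>\<X>\<^esub> k) x = \<eta> x powi k"
proof -
  interpret group "\<X> :: ('k \<Rightarrow> qbar) monoid" by (rule group_char)
  show ?thesis
  proof (cases "k < 0")
    case True
    have "\<eta> [^]\<^bsub>\<X>\<^esub> nat (- k) \<in> carrier \<X>" using assms(1) by (rule nat_pow_closed)
    from inv_char_apply[OF this, of x] show ?thesis
      using True by (simp only: int_pow_def2 nat_pow_char_apply[OF assms(2)] power_int_def if_True
        linorder_not_less[symmetric] not_True_eq_False if_False power_inverse)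
  next
    case False
    then show ?thesis
      by (simp only: int_pow_def2 nat_pow_char_apply[OF assms(2)] power_int_def if_False
        linorder_not_less[symmetric] not_False_eq_True if_True)
  qed
qed

lemma char_root_unity:
  fixes \<eta> :: "'k :: {field, finite} \<Rightarrow> qbar"
  assumes "\<eta> \<in> carrier \<X>" and "x \<noteq> 0"
  shows "\<eta> x ^ (CARD('k) - 1) = 1"
  unfolding char_power[OF assms(1), symmetric] finite_field_power_card_minus_1[OF assms(2)]
  by (rule char_one[OF assms(1)])

text \<open>
  The values of a character are 0 and roots of unity of order dividing \<open>q - 1\<close>, which leaves finitely
  many functions.
\<close>
lemma finite_char_group [simp]: "finite (carrier (\<X> :: ('k :: {field, finite} \<Rightarrow> qbar) monoid))"
proof -
  define Z :: "qbar set" where "Z = insert 0 {z. z ^ (CARD('k) - 1) = 1}"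
  have "CARD('k) - 1 > 0" using card_field_ge_2[where 'k = 'k] by simp
  then have "finite {z :: qbar. z ^ (CARD('k) - 1) = 1}"
    by (rule finite_nth_roots_idom)
  then have "finite Z" unfolding Z_def by (rule finite.insertI)
  then have "finite (UNIV \<rightarrow>\<^sub>E Z :: ('k \<Rightarrow> qbar) set)"
    by (intro finite_PiE) auto
  moreover have "carrier (\<X> :: ('k \<Rightarrow> qbar) monoid) \<subseteq> UNIV \<rightarrow>\<^sub>E Z"
  proof
    fix \<eta> :: "'k \<Rightarrow> qbar" assume "\<eta> \<in> carrier \<X>"
    then have "\<eta> x \<in> Z" for x
      using char_root_unity[of \<eta> x] char_zero[of \<eta>] by (cases "x = 0") (auto simp: Z_def)
    then show "\<eta> \<in> UNIV \<rightarrow>\<^sub>E Z" by auto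
  qed
  ultimately show ?thesis using finite_subset by blast
qed

text \<open>
  Fix a generator \<open>g\<close> of the multiplicative group and write \<open>u = g^k\<close> with \<open>0 < k < q - 1\<close>.  There are
  \<open>q - 1\<close> roots of unity with \<open>z^(q-1) = 1\<close> but only \<open>k\<close> with \<open>z^k = 1\<close>, so some \<open>z\<close> satisfies the first
  equation and not the second.  The character \<open>g^i \<mapsto> z^i\<close> then has the value \<open>z^k \<noteq> 1\<close> at \<open>u\<close>.
\<close>
lemma char_separates:
  fixes u :: "'k :: {field, finite}"
  assumes "u \<noteq> 0" and "u \<noteq> 1"
  obtains \<eta> :: "'k \<Rightarrow> qbar" where "\<eta> \<in> carrier \<X>" "\<eta> u \<noteq> 1"
proof -
  obtain g :: 'k where g: "g \<noteq> 0" "\<And>x. x \<noteq> 0 \<Longrightarrow> \<exists>i. x = g ^ i"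
      "\<And>k. g ^ k = 1 \<longleftrightarrow> CARD('k) - 1 dvd k"
    using cyclic_units_finite_field by metis
  let ?q = "CARD('k) - 1"
  have q: "?q > 0" using card_field_ge_2[where 'k = 'k] by simp
  obtain i where "u = g ^ i" using g(2) assms(1) by blast
  moreover define k where "k = i mod ?q"
  ultimately have u: "u = g ^ k"
    using power_mod_exponent[OF finite_field_power_card_minus_1[OF g(1)]] by metis
  have k: "0 < k" "k < ?q"
    using assms(2) q u by (auto simp: k_def intro: Nat.gr0I)
  have "card {z :: qbar. z ^ k = 1} = k" "card {z :: qbar. z ^ ?q = 1} = ?q"
    using k by (intro card_nth_roots_alg_closed; simp del: of_nat_diff)+
  then have "\<not> {z :: qbar. z ^ ?q = 1} \<subseteq> {z. z ^ k = 1}"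
    using k card_mono[OF finite_nth_roots_idom[OF k(1), of "1 :: qbar"]] by (metis leD)
  then obtain z :: qbar where z: "z ^ ?q = 1" "z ^ k \<noteq> 1" by blast
  have z0: "z \<noteq> 0" using z(1) q by (auto simp: power_0_left)
  \<comment> \<open>A discrete logarithm to the base \<open>g\<close>; the ambiguity in its choice is harmless by \<open>z_eq\<close>.\<close>
  define L where "L x = (SOME i. x = g ^ i)" for x
  have L: "g ^ L x = x" if "x \<noteq> 0" for x
    using someI_ex[OF g(2)[OF that]] by (simp add: L_def)
  have z_eq: "z ^ i = z ^ j" if "g ^ i = g ^ j" for i j
  proof -
    have *: "z ^ i = z ^ j" if "g ^ i = g ^ j" "i \<le> j" for i j
    proof -
      have "g ^ j = g ^ i * g ^ (j - i)" using that(2) by (simp flip: power_add)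
      then have "g ^ (j - i) = 1" using that g(1) by simp
      then obtain e where "j - i = ?q * e" using g(3) by blast
      then have "z ^ (j - i) = 1" by (simp only: power_mult z(1) power_one)
      moreover have "z ^ j = z ^ i * z ^ (j - i)" using that(2) by (simp flip: power_add)
      ultimately show ?thesis by simp
    qed
    show ?thesis
    proof (cases "i \<le> j")
      case True
      with that show ?thesis by (rule *)
    next
      case False
      then have "j \<le> i" by simp
      with that[symmetric] show ?thesis by (rule *[symmetric])
    qed
  qed
  define \<eta> where "\<eta> x = (if x = 0 then 0 else z ^ L x)" for x
  have "z ^ L (x * y) = z ^ L x * z ^ L y" if "x \<noteq> 0" "y \<noteq> 0" for x y
    unfolding power_add[symmetric] by (rule z_eq) (simp add: L that power_add)
  then have "\<eta> \<in> carrier \<X>"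
    unfolding char_iff by (simp add: \<eta>_def z0)
  moreover have "\<eta> u = z ^ k"
    using assms(1) z_eq[of "L u" k] by (simp add: \<eta>_def L u)
  ultimately show ?thesis using z(2) that by metis
qed

text \<open>
  If \<open>\<eta>(u) \<noteq> 1\<close> for some \<open>u \<noteq> 0\<close>, the substitution \<open>x \<mapsto> u x\<close> multiplies the sum by \<open>\<eta>(u)\<close> and leaves it
  unchanged.
\<close>
lemma sum_char_UNIV:
  fixes \<eta> :: "'k :: {field, finite} \<Rightarrow> qbar"
  assumes "\<eta> \<in> carrier \<X>"
  shows "(\<Sum>x\<in>UNIV. \<eta> x) = (if \<eta> = \<one>\<^bsub>\<X>\<^esub> then of_nat CARD('k) - 1 else 0)"
proof (cases "\<eta> = \<one>\<^bsub>\<X>\<^esub>")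
  case True
  have "(\<Sum>x\<in>UNIV. \<eta> x) = (\<Sum>x\<in>UNIV - {0 :: 'k}. 1)"
    by (intro sum.mono_neutral_cong_right) (auto simp: True one_char_apply)
  then show ?thesis
    using True card_field_ge_2[where 'k = 'k] by (simp add: card_Diff_subset of_nat_diff)
next
  case False
  then obtain u where "\<eta> u \<noteq> \<one>\<^bsub>\<X>\<^esub> u" by blast
  then have u: "u \<noteq> 0" "\<eta> u \<noteq> 1"
    using char_zero[OF assms] by (auto simp: one_char_apply split: if_splits)
  have "\<eta> u * (\<Sum>x\<in>UNIV. \<eta> x) = (\<Sum>x\<in>UNIV. \<eta> (u * x))"
    by (simp add: sum_distrib_left char_mult[OF assms])
  also have "\<dots> = (\<Sum>x\<in>UNIV. \<eta> x)"
    by (rule sum.reindex_bij_witness[of _ "\<lambda>x. x / u" "\<lambda>x. u * x"]) (use u in auto)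
  finally show ?thesis using u False by simp
qed

text \<open>
  The dual relation: here the sum is multiplied by \<open>\<eta>(u)\<close> for a character \<open>\<eta>\<close> that separates \<open>u\<close> from 1.
\<close>
lemma sum_char_group_eq_0:
  fixes u :: "'k :: {field, finite}"
  assumes "u \<noteq> 1"
  shows "(\<Sum>\<nu>\<in>carrier \<X>. \<nu> u) = 0"
proof (cases "u = 0")
  case False
  interpret group "\<X> :: ('k \<Rightarrow> qbar) monoid" by (rule group_char)
  obtain \<eta> :: "'k \<Rightarrow> qbar" where \<eta>: "\<eta> \<in> carrier \<X>" "\<eta> u \<noteq> 1"
    using char_separates[OF False assms] by blast
  have "\<eta> u * (\<Sum>\<nu>\<in>carrier \<X>. \<nu> u) = (\<Sum>\<nu>\<in>carrier \<X>. (\<eta> \<otimes>\<^bsub>\<X>\<^esub> \<nu>) u)"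
    by (simp add: sum_distrib_left mult_char_apply)
  also have "\<dots> = (\<Sum>\<nu>\<in>carrier \<X>. \<nu> u)"
    by (rule sum.reindex_bij_witness[of _ "\<lambda>\<nu>. inv\<^bsub>\<X>\<^esub> \<eta> \<otimes>\<^bsub>\<X>\<^esub> \<nu>" "\<lambda>\<nu>. \<eta> \<otimes>\<^bsub>\<X>\<^esub> \<nu>"])
      (use \<eta> in \<open>auto simp: m_assoc[symmetric]\<close>)
  finally show ?thesis using \<eta> by simp
qed (simp add: char_zero)

text \<open>
  Summing \<open>\<nu>(u)\<close> over all \<open>u\<close> and all \<open>\<nu>\<close>, only \<open>u = 1\<close> contributes in one order of summation and only
  the trivial character in the other.
\<close>
lemma card_char_group: "card (carrier (\<X> :: ('k :: {field, finite} \<Rightarrow> qbar) monoid)) = CARD('k) - 1"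
proof -
  let ?X = "carrier (\<X> :: ('k \<Rightarrow> qbar) monoid)"
  have "(\<Sum>u\<in>UNIV. \<Sum>\<nu>\<in>?X. \<nu> u) = (\<Sum>u\<in>(UNIV :: 'k set). if u = 1 then of_nat (card ?X) else 0)"
    by (intro sum.cong refl) (simp add: sum_char_group_eq_0 char_one)
  also have "\<dots> = of_nat (card ?X)" by simp
  finally have "of_nat (card ?X) = (\<Sum>\<nu>\<in>?X. \<Sum>u\<in>UNIV. \<nu> u)"
    by (subst sum.swap) simp
  also have "\<dots> = (\<Sum>\<nu>\<in>?X. if \<nu> = \<one>\<^bsub>\<X>\<^esub> then of_nat CARD('k) - 1 else 0)"
    by (intro sum.cong refl) (auto simp: sum_char_UNIV)
  also have "\<dots> = of_nat (CARD('k) - 1)"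
    using card_field_ge_2[where 'k = 'k] by (simp add: of_nat_diff)
  finally show ?thesis by (simp only: of_nat_eq_iff)
qed

lemma sum_char_group:
  fixes u :: "'k :: {field, finite}"
  shows "(\<Sum>\<nu>\<in>carrier \<X>. \<nu> u) = (if u = 1 then of_nat CARD('k) - 1 else 0)"
proof (cases "u = 1")
  case True
  then have "(\<Sum>\<nu>\<in>carrier \<X>. \<nu> u) = of_nat (card (carrier (\<X> :: ('k \<Rightarrow> qbar) monoid)))"
    by (simp add: char_one)
  then show ?thesis
    using True card_field_ge_2[where 'k = 'k] by (simp add: card_char_group of_nat_diff)
qed (simp add: sum_char_group_eq_0)

text \<open>
  A generator of the character group has order \<open>q - 1\<close>, the order of the group.
\<close>
lemma int_pow_char_eq_one_iff:
  fixes \<phi> :: "'k :: {field, finite} \<Rightarrow> qbar"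
  assumes "\<phi> \<in> carrier \<X>" and "generate \<X> {\<phi>} = carrier \<X>"
  shows "\<phi> [^]\<^bsub>\<X>\<^esub> (k :: int) = \<one>\<^bsub>\<X>\<^esub> \<longleftrightarrow> int (CARD('k) - 1) dvd k"
proof -
  interpret group "\<X> :: ('k \<Rightarrow> qbar) monoid" by (rule group_char)
  have "ord \<phi> = CARD('k) - 1"
    using generate_pow_card[OF assms(1)] assms(2) card_char_group[where 'k = 'k] by simp
  then show ?thesis using int_pow_eq_id[OF assms(1)] by simp
qed

lemma char_root_int_pow_eq_one_iff:
  fixes \<phi> :: "'k :: {field, finite} \<Rightarrow> qbar" and k :: int
  assumes \<phi>: "\<phi> \<in> carrier \<X>" "generate \<X> {\<phi>} = carrier \<X>" and d: "d dvd CARD('k) - 1"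
  shows "char_root \<phi> d [^]\<^bsub>\<X>\<^esub> k = \<one>\<^bsub>\<X>\<^esub> \<longleftrightarrow> int d dvd k"
proof -
  interpret group "\<X> :: ('k \<Rightarrow> qbar) monoid" by (rule group_char)
  define e where "e = (CARD('k) - 1) div d"
  have de: "CARD('k) - 1 = d * e" using d by (simp add: e_def)
  have "e > 0" using de card_field_ge_2[where 'k = 'k] by (cases e) auto
  have "char_root \<phi> d [^]\<^bsub>\<X>\<^esub> k = \<phi> [^]\<^bsub>\<X>\<^esub> (int e * k)"
    unfolding char_root_def e_def[symmetric] int_pow_pow[OF \<phi>(1), symmetric] int_pow_int ..
  then show ?thesis
    using \<open>e > 0\<close> by (simp only: int_pow_char_eq_one_iff[OF \<phi>] de)
      (simp add: mult.commute)
qed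

lemma char_root_closed:
  assumes "\<phi> \<in> carrier (\<X> :: ('k :: {field, finite} \<Rightarrow> qbar) monoid)"
  shows "char_root \<phi> d \<in> carrier \<X>"
  unfolding char_root_def using assms by (rule monoid.nat_pow_closed[OF group.is_monoid[OF group_char]])

lemma char_root_apply:
  fixes \<phi> :: "'k :: {field, finite} \<Rightarrow> qbar"
  assumes "\<phi> \<in> carrier \<X>" and "x \<noteq> 0"
  shows "char_root \<phi> d x = \<phi> (x ^ ((CARD('k) - 1) div d))"
  unfolding char_root_def nat_pow_char_apply[OF assms(2)] char_power[OF assms(1)] ..

section \<open>Gauss and Jacobi sums\<close>

lemma gauss_sum_UNIV:
  assumes "\<eta> \<in> carrier \<X>"
  shows "gauss_sum \<psi> \<eta> = - (\<Sum>x\<in>UNIV. \<psi> x * \<eta> x)"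
  unfolding gauss_sum_def
  by (subst sum.mono_neutral_right[of UNIV "UNIV - {0}"]) (auto simp: char_zero[OF assms])

text \<open>
  Translation by \<open>u\<close> with \<open>\<psi>(u) \<noteq> 1\<close> multiplies the sum by \<open>\<psi>(u)\<close> and leaves it unchanged.
\<close>
lemma sum_add_char:
  assumes "nontrivial_add_char \<psi>"
  shows "(\<Sum>x\<in>UNIV. \<psi> x) = 0"
proof -
  have add: "\<psi> (x + y) = \<psi> x * \<psi> y" for x y
    using assms by (simp add: nontrivial_add_char_def)
  obtain u where u: "\<psi> u \<noteq> 1"
    using assms by (auto simp: nontrivial_add_char_def)
  have "\<psi> u * (\<Sum>x\<in>UNIV. \<psi> x) = (\<Sum>x\<in>UNIV. \<psi> (u + x))"
    by (simp add: sum_distrib_left add)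
  also have "\<dots> = (\<Sum>x\<in>UNIV. \<psi> x)"
    by (rule sum.reindex_bij_witness[of _ "\<lambda>x. x - u" "\<lambda>x. u + x"]) auto
  finally show ?thesis using u by simp
qed

lemma add_char_zero:
  assumes "nontrivial_add_char \<psi>"
  shows "\<psi> 0 = 1"
proof -
  have "\<psi> 0 * \<psi> 0 = \<psi> 0 * 1"
    using assms unfolding nontrivial_add_char_def by (metis add_0 mult_1_right)
  moreover have "\<psi> 0 \<noteq> 0" using assms unfolding nontrivial_add_char_def by blast
  ultimately show ?thesis by simp
qed

lemma gauss_sum_one:
  assumes "nontrivial_add_char \<psi>"
  shows "gauss_sum \<psi> \<one>\<^bsub>\<X>\<^esub> = 1"
proof -
  have "gauss_sum \<psi> \<one>\<^bsub>\<X>\<^esub> = - (\<Sum>x\<in>UNIV - {0}. \<psi> x)"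
    unfolding gauss_sum_def by (intro arg_cong[of _ _ uminus] sum.cong) (simp_all add: one_char_apply)
  also have "\<dots> = \<psi> 0 - (\<Sum>x\<in>UNIV. \<psi> x)"
    by (subst (2) sum.remove[of _ 0]) auto
  finally show ?thesis
    by (simp only: sum_add_char[OF assms] add_char_zero[OF assms]) simp
qed

text \<open>
  For \<open>u \<noteq> 0\<close> substitute \<open>x / u\<close> for \<open>x\<close>.  For \<open>u = 0\<close> both sides vanish: the left-hand side because \<open>\<eta>\<close> is
  nontrivial, the right-hand side by the convention \<open>inverse 0 = 0\<close>.
\<close>
lemma gauss_sum_scale:
  assumes "\<eta> \<in> carrier \<X>" and "\<eta> \<noteq> \<one>\<^bsub>\<X>\<^esub>" and \<psi>: "nontrivial_add_char \<psi>"
  shows "(\<Sum>x\<in>UNIV. \<psi> (x * u) * \<eta> x) = - (inverse (\<eta> u) * gauss_sum \<psi> \<eta>)"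
proof (cases "u = 0")
  case True
  then show ?thesis
    using assms(2) by (simp add: char_zero[OF assms(1)] add_char_zero[OF \<psi>] sum_char_UNIV[OF assms(1)])
next
  case False
  have "\<eta> u * (\<Sum>x\<in>UNIV. \<psi> (x * u) * \<eta> x) = (\<Sum>x\<in>UNIV. \<psi> (x * u) * \<eta> (x * u))"
    by (simp add: sum_distrib_left char_mult[OF assms(1)] mult_ac)
  also have "\<dots> = (\<Sum>x\<in>UNIV. \<psi> x * \<eta> x)"
    by (rule sum.reindex_bij_witness[of _ "\<lambda>x. x / u" "\<lambda>x. x * u"]) (use False in auto)
  also have "\<dots> = - gauss_sum \<psi> \<eta>"
    by (simp add: gauss_sum_UNIV[OF assms(1)])
  finally show ?thesis
    using False by (simp add: field_simps char_eq_0_iff[OF assms(1)])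
qed

lemma jacobi_sum_pair:
  fixes \<alpha> \<chi> :: "'k :: {field, finite} \<Rightarrow> qbar"
  assumes \<alpha>: "\<alpha> \<in> carrier \<X>" and \<chi>: "\<chi> \<in> carrier \<X>"
  shows "jacobi_sum [\<alpha>, \<chi>] = - (\<Sum>x\<in>UNIV. \<alpha> x * \<chi> (1 - x))"
proof -
  let ?S = "{xs :: 'k list. set xs \<subseteq> UNIV - {0} \<and> length xs = length [\<alpha>, \<chi>] \<and> sum_list xs = 1}"
  \<comment> \<open>The pairs of nonzero elements with sum 1 are parametrised by their first entry.\<close>
  have S: "?S = (\<lambda>x. [x, 1 - x]) ` (UNIV - {0, 1})"
  proof (intro equalityI subsetI)
    fix xs assume xs: "xs \<in> ?S"
    then obtain y z where yz: "xs = [y, z]"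
      by (auto simp: length_Suc_conv numeral_2_eq_2)
    moreover from xs have "z = 1 - y"
      unfolding yz by (simp add: eq_diff_eq add.commute)
    ultimately show "xs \<in> (\<lambda>x. [x, 1 - x]) ` (UNIV - {0, 1})"
      using xs by (intro image_eqI[of _ _ y]) auto
  qed auto
  have "(\<Sum>xs\<in>?S. \<Prod>i<length [\<alpha>, \<chi>]. ([\<alpha>, \<chi>] ! i) (xs ! i)) = (\<Sum>x\<in>UNIV - {0, 1}. \<alpha> x * \<chi> (1 - x))"
    unfolding S by (subst sum.reindex) (auto simp: inj_on_def numeral_2_eq_2 lessThan_Suc mult_ac)
  also have "\<dots> = (\<Sum>x\<in>UNIV. \<alpha> x * \<chi> (1 - x))"
    by (rule sum.mono_neutral_left) (auto simp: char_zero[OF \<alpha>] char_zero[OF \<chi>])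
  finally show ?thesis unfolding jacobi_sum_def by simp
qed

text \<open>
  Substituting \<open>s x\<close> for \<open>x\<close> pulls \<open>\<alpha>(s) \<chi>(s)\<close> out of the sum.
\<close>
lemma sum_char_convolution:
  assumes \<alpha>: "\<alpha> \<in> carrier \<X>" and \<chi>: "\<chi> \<in> carrier \<X>" and "s \<noteq> 0"
  shows "(\<Sum>x\<in>UNIV. \<alpha> x * \<chi> (s - x)) = - ((\<alpha> \<otimes>\<^bsub>\<X>\<^esub> \<chi>) s * jacobi_sum [\<alpha>, \<chi>])"
proof -
  have "(\<Sum>x\<in>UNIV. \<alpha> x * \<chi> (s - x)) = (\<Sum>x\<in>UNIV. \<alpha> (s * x) * \<chi> (s - s * x))"
    by (rule sum.reindex_bij_witness[of _ "\<lambda>x. s * x" "\<lambda>x. x / s"]) (use assms in auto)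
  also have "\<dots> = (\<Sum>x\<in>UNIV. \<alpha> (s * x) * \<chi> (s * (1 - x)))"
    by (simp add: right_diff_distrib)
  also have "\<dots> = (\<Sum>x\<in>UNIV. (\<alpha> \<otimes>\<^bsub>\<X>\<^esub> \<chi>) s * (\<alpha> x * \<chi> (1 - x)))"
    by (simp add: char_mult[OF \<alpha>] char_mult[OF \<chi>] mult_char_apply mult_ac)
  finally show ?thesis
    by (simp add: jacobi_sum_pair[OF \<alpha> \<chi>] sum_distrib_left)
qed

text \<open>
  When \<open>\<alpha>\<close> is the inverse of \<open>\<chi>\<close>, the summand is \<open>\<chi>((1 - x) / x)\<close>, and \<open>1 / x - 1\<close> runs through all elements
  except \<open>-1\<close>.  The full sum of \<open>\<chi>\<close> being 0, the missing term gives the value.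
\<close>
lemma jacobi_sum_inverse_pair:
  assumes \<alpha>: "\<alpha> \<in> carrier \<X>" and \<chi>: "\<chi> \<in> carrier \<X>" and "\<chi> \<noteq> \<one>\<^bsub>\<X>\<^esub>"
    and inv: "\<alpha> \<otimes>\<^bsub>\<X>\<^esub> \<chi> = \<one>\<^bsub>\<X>\<^esub>"
  shows "jacobi_sum [\<alpha>, \<chi>] = \<chi> (- 1)"
proof -
  have *: "\<alpha> x * \<chi> (1 - x) = \<chi> (1 / x - 1)" if "x \<noteq> 0" for x
  proof -
    have "\<chi> (1 - x) = \<chi> (x * (1 / x - 1))" using that by (simp add: right_diff_distrib)
    then have "\<alpha> x * \<chi> (1 - x) = (\<alpha> \<otimes>\<^bsub>\<X>\<^esub> \<chi>) x * \<chi> (1 / x - 1)"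
      by (simp add: char_mult[OF \<chi>] mult_char_apply mult_ac)
    then show ?thesis using that by (simp add: inv one_char_apply)
  qed
  have "(\<Sum>x\<in>UNIV. \<alpha> x * \<chi> (1 - x)) = (\<Sum>x\<in>UNIV - {0}. \<alpha> x * \<chi> (1 - x))"
    by (rule sum.mono_neutral_right) (auto simp: char_zero[OF \<alpha>])
  also have "\<dots> = (\<Sum>x\<in>UNIV - {0}. \<chi> (1 / x - 1))"
    by (intro sum.cong refl) (auto simp: *)
  also have "\<dots> = (\<Sum>u\<in>UNIV - {- 1}. \<chi> u)"
    by (rule sum.reindex_bij_witness[of _ "\<lambda>u. 1 / (u + 1)" "\<lambda>x. 1 / x - 1"])
      (auto simp: add_eq_0_iff2)
  also have "\<dots> = (\<Sum>u\<in>UNIV. \<chi> u) - \<chi> (- 1)"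
    by (subst (2) sum.remove[of _ "- 1"]) auto
  finally show ?thesis
    using assms(3) by (simp add: jacobi_sum_pair[OF \<alpha> \<chi>] sum_char_UNIV[OF \<chi>])
qed

text \<open>
  Collect the terms of the double sum \<open>\<Sum> \<psi>(x + y) \<alpha>(x) \<chi>(y)\<close> according to \<open>s = x + y\<close>.  The terms with
  \<open>s \<noteq> 0\<close> give \<open>j(\<alpha>, \<chi>) g(\<alpha>\<chi>)\<close>; those with \<open>s = 0\<close> contribute only if \<open>\<alpha>\<chi>\<close> is trivial, and then
  \<open>j(\<alpha>, \<chi>) = \<chi>(-1)\<close> makes the two parts add up to \<open>q j(\<alpha>, \<chi>)\<close>, which is why \<open>g\<degree>\<close> appears on the
  right.
\<close>
lemma gauss_sum_mult:
  fixes \<psi> :: "'k :: {field, finite} \<Rightarrow> qbar"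
  assumes \<psi>: "nontrivial_add_char \<psi>" and \<alpha>: "\<alpha> \<in> carrier \<X>" and \<chi>: "\<chi> \<in> carrier \<X>"
    and "\<chi> \<noteq> \<one>\<^bsub>\<X>\<^esub>"
  shows "gauss_sum \<psi> \<alpha> * gauss_sum \<psi> \<chi> = jacobi_sum [\<alpha>, \<chi>] * gauss_sum0 \<psi> (\<alpha> \<otimes>\<^bsub>\<X>\<^esub> \<chi>)"
proof -
  let ?\<gamma> = "\<alpha> \<otimes>\<^bsub>\<X>\<^esub> \<chi>"
  have \<gamma>: "?\<gamma> \<in> carrier \<X>" using \<alpha> \<chi> by (rule mult_char_closed)
  have add: "\<psi> (x + y) = \<psi> x * \<psi> y" for x y
    using \<psi> by (simp add: nontrivial_add_char_def)
  have "gauss_sum \<psi> \<alpha> * gauss_sum \<psi> \<chi> = (\<Sum>x\<in>UNIV. \<Sum>y\<in>UNIV. \<psi> (x + y) * (\<alpha> x * \<chi> y))"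
    by (simp add: gauss_sum_UNIV[OF \<alpha>] gauss_sum_UNIV[OF \<chi>] sum_product add mult_ac)
  also have "\<dots> = (\<Sum>x\<in>UNIV. \<Sum>s\<in>UNIV. \<psi> s * (\<alpha> x * \<chi> (s - x)))"
  proof (rule sum.cong[OF refl])
    fix x
    show "(\<Sum>y\<in>UNIV. \<psi> (x + y) * (\<alpha> x * \<chi> y)) = (\<Sum>s\<in>UNIV. \<psi> s * (\<alpha> x * \<chi> (s - x)))"
      by (rule sum.reindex_bij_witness[of _ "\<lambda>s. s - x" "\<lambda>y. x + y"]) auto
  qed
  also have "\<dots> = (\<Sum>s\<in>UNIV. \<psi> s * (\<Sum>x\<in>UNIV. \<alpha> x * \<chi> (s - x)))"
    unfolding sum_distrib_left by (rule sum.swap)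
  also have "\<dots> = (\<Sum>x\<in>UNIV. \<alpha> x * \<chi> (- x)) + (\<Sum>s\<in>UNIV - {0}. \<psi> s * (\<Sum>x\<in>UNIV. \<alpha> x * \<chi> (s - x)))"
    by (subst sum.remove[of UNIV 0]) (simp_all add: add_char_zero[OF \<psi>])
  also have "(\<Sum>x\<in>UNIV. \<alpha> x * \<chi> (- x)) = \<chi> (- 1) * (\<Sum>x\<in>UNIV. ?\<gamma> x)"
  proof -
    have "\<alpha> x * \<chi> (- x) = \<chi> (- 1) * ?\<gamma> x" for x
      using char_mult[OF \<chi>, of "- 1" x] by (simp add: mult_char_apply mult_ac)
    then show ?thesis by (simp only: sum_distrib_left)
  qed
  also have "(\<Sum>s\<in>UNIV - {0}. \<psi> s * (\<Sum>x\<in>UNIV. \<alpha> x * \<chi> (s - x))) =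
      (\<Sum>s\<in>UNIV - {0}. \<psi> s * - (?\<gamma> s * jacobi_sum [\<alpha>, \<chi>]))"
    by (rule sum.cong[OF refl], subst sum_char_convolution[OF \<alpha> \<chi>]) simp_all
  also have "\<dots> = jacobi_sum [\<alpha>, \<chi>] * gauss_sum \<psi> ?\<gamma>"
    by (simp add: gauss_sum_def sum_distrib_left sum_negf mult_ac)
  finally have *: "gauss_sum \<psi> \<alpha> * gauss_sum \<psi> \<chi> =
      \<chi> (- 1) * (\<Sum>x\<in>UNIV. ?\<gamma> x) + jacobi_sum [\<alpha>, \<chi>] * gauss_sum \<psi> ?\<gamma>" .
  show ?thesis
  proof (cases "?\<gamma> = \<one>\<^bsub>\<X>\<^esub>")
    case False
    then show ?thesis
      by (simp add: * sum_char_UNIV[OF \<gamma>] gauss_sum0_def)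
  next
    case True
    show ?thesis
      unfolding * sum_char_UNIV[OF \<gamma>] gauss_sum0_def jacobi_sum_inverse_pair[OF \<alpha> \<chi> assms(4) True]
      by (simp add: True gauss_sum_one[OF \<psi>] right_diff_distrib)
  qed
qed

text \<open>
  The reflection formula \<open>g(\<eta>) g(\<eta>\<^sup>-\<^sup>1) = \<eta>(-1) q\<close> for nontrivial \<open>\<eta>\<close>, in a form that covers the
  trivial character as well.  It shows that Gauss sums do not vanish and turns the denominators
  \<open>(\<epsilon>)\<degree>\<^sub>\<nu>\<close> into products.
\<close>
lemma gauss_sum_inverse:
  fixes \<psi> :: "'k :: {field, finite} \<Rightarrow> qbar"
  assumes \<psi>: "nontrivial_add_char \<psi>" and \<eta>: "\<eta> \<in> carrier \<X>"
  shows "gauss_sum0 \<psi> \<eta> * (\<eta> (- 1) * gauss_sum \<psi> (inv\<^bsub>\<X>\<^esub> \<eta>)) = of_nat CARD('k)"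
proof (cases "\<eta> = \<one>\<^bsub>\<X>\<^esub>")
  case True
  have "inv\<^bsub>\<X>\<^esub> \<one>\<^bsub>\<X>\<^esub> = (\<one>\<^bsub>\<X>\<^esub> :: 'k \<Rightarrow> qbar)"
    by (rule monoid.inv_one[OF group.is_monoid[OF group_char]])
  then show ?thesis
    by (simp add: True gauss_sum0_def gauss_sum_one[OF \<psi>] one_char_apply)
next
  case False
  have inv: "inv\<^bsub>\<X>\<^esub> \<eta> \<otimes>\<^bsub>\<X>\<^esub> \<eta> = \<one>\<^bsub>\<X>\<^esub>"
    using \<eta> by (rule group.l_inv[OF group_char])
  have g: "gauss_sum \<psi> (inv\<^bsub>\<X>\<^esub> \<eta>) * gauss_sum \<psi> \<eta> = \<eta> (- 1) * of_nat CARD('k)"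
    unfolding gauss_sum_mult[OF \<psi> inv_char_closed[OF \<eta>] \<eta> False] inv
      jacobi_sum_inverse_pair[OF inv_char_closed[OF \<eta>] \<eta> False inv]
    by (simp add: gauss_sum0_def gauss_sum_one[OF \<psi>])
  have "gauss_sum \<psi> \<eta> * (\<eta> (- 1) * gauss_sum \<psi> (inv\<^bsub>\<X>\<^esub> \<eta>)) =
      \<eta> (- 1) * (gauss_sum \<psi> (inv\<^bsub>\<X>\<^esub> \<eta>) * gauss_sum \<psi> \<eta>)"
    by (simp only: mult_ac)
  also have "\<dots> = \<eta> (- 1) * \<eta> (- 1) * of_nat CARD('k)"
    unfolding g by (simp only: mult.assoc)
  also have "\<eta> (- 1) * \<eta> (- 1) = 1"
    by (simp add: char_one[OF \<eta>] flip: char_mult[OF \<eta>])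
  finally show ?thesis
    using False by (simp add: gauss_sum0_def)
qed

lemma gauss_sum0_nonzero:
  fixes \<psi> :: "'k :: {field, finite} \<Rightarrow> qbar"
  assumes "nontrivial_add_char \<psi>" and "\<eta> \<in> carrier \<X>"
  shows "gauss_sum0 \<psi> \<eta> \<noteq> 0"
proof
  assume "gauss_sum0 \<psi> \<eta> = 0"
  then have "of_nat CARD('k) = (0 :: qbar)"
    using gauss_sum_inverse[OF assms] by simp
  then show False by simp
qed

lemma gauss_sum_nonzero:
  assumes "nontrivial_add_char \<psi>" and "\<eta> \<in> carrier \<X>"
  shows "gauss_sum \<psi> \<eta> \<noteq> 0"
  using gauss_sum0_nonzero[OF assms] by (auto simp: gauss_sum0_def)

text \<open>
  The analogue of \<open>B(\<alpha> + n, \<chi>) = B(\<alpha>, \<chi>) (\<alpha>)\<^sub>n / (\<alpha> + \<chi>)\<^sub>n\<close> for the beta function: express both Jacobi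
  sums by Gauss sums and divide.
\<close>
lemma jacobi_sum_mult_char:
  fixes \<psi> :: "'k :: {field, finite} \<Rightarrow> qbar"
  assumes \<psi>: "nontrivial_add_char \<psi>" and \<alpha>: "\<alpha> \<in> carrier \<X>" and \<chi>: "\<chi> \<in> carrier \<X>"
    and \<nu>: "\<nu> \<in> carrier \<X>" and "\<chi> \<noteq> \<one>\<^bsub>\<X>\<^esub>"
  shows "jacobi_sum [\<alpha> \<otimes>\<^bsub>\<X>\<^esub> \<nu>, \<chi>] =
    jacobi_sum [\<alpha>, \<chi>] * (poch \<psi> \<alpha> \<nu> / poch0 \<psi> (\<alpha> \<otimes>\<^bsub>\<X>\<^esub> \<chi>) \<nu>)"
proof -
  let ?\<gamma> = "\<alpha> \<otimes>\<^bsub>\<X>\<^esub> \<chi>"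
  have \<gamma>: "?\<gamma> \<in> carrier \<X>" and \<alpha>\<nu>: "\<alpha> \<otimes>\<^bsub>\<X>\<^esub> \<nu> \<in> carrier \<X>"
    and \<gamma>\<nu>: "?\<gamma> \<otimes>\<^bsub>\<X>\<^esub> \<nu> \<in> carrier \<X>"
    using \<alpha> \<chi> \<nu> by (simp_all only: mult_char_closed)
  have comm: "\<alpha> \<otimes>\<^bsub>\<X>\<^esub> \<nu> \<otimes>\<^bsub>\<X>\<^esub> \<chi> = ?\<gamma> \<otimes>\<^bsub>\<X>\<^esub> \<nu>"
    by (rule ext) (simp add: mult_char_apply mult_ac)
  have "jacobi_sum [\<alpha> \<otimes>\<^bsub>\<X>\<^esub> \<nu>, \<chi>] =
      gauss_sum \<psi> (\<alpha> \<otimes>\<^bsub>\<X>\<^esub> \<nu>) * gauss_sum \<psi> \<chi> / gauss_sum0 \<psi> (?\<gamma> \<otimes>\<^bsub>\<X>\<^esub> \<nu>)"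
    using gauss_sum_mult[OF \<psi> \<alpha>\<nu> \<chi> assms(5)] gauss_sum0_nonzero[OF \<psi> \<gamma>\<nu>]
    by (simp add: comm)
  moreover have "jacobi_sum [\<alpha>, \<chi>] = gauss_sum \<psi> \<alpha> * gauss_sum \<psi> \<chi> / gauss_sum0 \<psi> ?\<gamma>"
    using gauss_sum_mult[OF \<psi> \<alpha> \<chi> assms(5)] gauss_sum0_nonzero[OF \<psi> \<gamma>] by simp
  ultimately show ?thesis
    using gauss_sum_nonzero[OF \<psi> \<alpha>] gauss_sum0_nonzero[OF \<psi> \<gamma>]
    by (simp add: poch_def poch0_def)
qed

section \<open>The binomial theorem\<close>

text \<open>
  The analogue of \<open>\<Sum>\<^sub>n (\<beta>)\<^sub>n / n! t^n = (1 - t)^(-\<beta>)\<close>.  By the reflection formula the term at \<open>\<nu>\<close> is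
  \<open>g(\<beta>\<nu>) g(\<nu>\<^sup>-\<^sup>1) \<nu>(-t) / g(\<beta>)\<close>.  Writing out the two Gauss sums over \<open>s\<close> and \<open>r\<close>, summation over \<open>\<nu>\<close> leaves
  only the terms with \<open>r = - s t\<close>, and the sum over \<open>s\<close> that remains is a rescaled Gauss sum of \<open>\<beta>\<close>.  At
  \<open>t = 1\<close> both sides are 0, since \<open>\<beta>\<close> is nontrivial and \<open>inverse 0 = 0\<close>; for trivial \<open>\<beta>\<close> the formula would
  fail there.
\<close>
lemma binomial_theorem_char:
  fixes \<psi> \<beta> :: "'k :: {field, finite} \<Rightarrow> qbar"
  assumes \<psi>: "nontrivial_add_char \<psi>" and \<beta>: "\<beta> \<in> carrier \<X>" and "\<beta> \<noteq> \<one>\<^bsub>\<X>\<^esub>" and "t \<noteq> 0"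
  shows "(\<Sum>\<nu>\<in>carrier \<X>. poch \<psi> \<beta> \<nu> / poch0 \<psi> \<one>\<^bsub>\<X>\<^esub> \<nu> * \<nu> t) =
    (1 - of_nat CARD('k)) * inverse (\<beta> (1 - t))"
proof -
  let ?q = "of_nat CARD('k) :: qbar" and ?X = "carrier (\<X> :: ('k \<Rightarrow> qbar) monoid)"
  have q: "?q \<noteq> 0" by simp
  have add: "\<psi> (x + y) = \<psi> x * \<psi> y" for x y
    using \<psi> by (simp add: nontrivial_add_char_def)
  have g\<beta>: "gauss_sum \<psi> \<beta> \<noteq> 0" using \<psi> \<beta> by (rule gauss_sum_nonzero)
  have g0_one: "gauss_sum0 \<psi> \<one>\<^bsub>\<X>\<^esub> = ?q"
    by (simp add: gauss_sum0_def gauss_sum_one[OF \<psi>])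
  have coeff: "poch \<psi> \<beta> \<nu> / poch0 \<psi> \<one>\<^bsub>\<X>\<^esub> \<nu> * \<nu> t =
      gauss_sum \<psi> (\<beta> \<otimes>\<^bsub>\<X>\<^esub> \<nu>) * gauss_sum \<psi> (inv\<^bsub>\<X>\<^esub> \<nu>) * \<nu> (- t) / gauss_sum \<psi> \<beta>"
    if \<nu>: "\<nu> \<in> ?X" for \<nu>
  proof -
    have g: "gauss_sum0 \<psi> \<nu> \<noteq> 0" using \<psi> \<nu> by (rule gauss_sum0_nonzero)
    have "\<one>\<^bsub>\<X>\<^esub> \<otimes>\<^bsub>\<X>\<^esub> \<nu> = \<nu>"
      using \<nu> by (rule monoid.l_one[OF group.is_monoid[OF group_char]])
    then have "poch0 \<psi> \<one>\<^bsub>\<X>\<^esub> \<nu> = gauss_sum0 \<psi> \<nu> / ?q"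
      by (simp only: poch0_def g0_one)
    then have "1 / poch0 \<psi> \<one>\<^bsub>\<X>\<^esub> \<nu> = ?q / gauss_sum0 \<psi> \<nu>"
      by simp
    also have "\<dots> = \<nu> (- 1) * gauss_sum \<psi> (inv\<^bsub>\<X>\<^esub> \<nu>)"
      using g gauss_sum_inverse[OF \<psi> \<nu>, symmetric] by simp
    finally have p: "1 / poch0 \<psi> \<one>\<^bsub>\<X>\<^esub> \<nu> = \<nu> (- 1) * gauss_sum \<psi> (inv\<^bsub>\<X>\<^esub> \<nu>)" .
    have "poch \<psi> \<beta> \<nu> / poch0 \<psi> \<one>\<^bsub>\<X>\<^esub> \<nu> * \<nu> t =
        poch \<psi> \<beta> \<nu> * (1 / poch0 \<psi> \<one>\<^bsub>\<X>\<^esub> \<nu>) * \<nu> t" by simp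
    also have "\<dots> = gauss_sum \<psi> (\<beta> \<otimes>\<^bsub>\<X>\<^esub> \<nu>) * gauss_sum \<psi> (inv\<^bsub>\<X>\<^esub> \<nu>) * (\<nu> (- 1) * \<nu> t) / gauss_sum \<psi> \<beta>"
      unfolding p poch_def by simp
    also have "\<nu> (- 1) * \<nu> t = \<nu> (- t)" by (simp flip: char_mult[OF \<nu>])
    finally show ?thesis .
  qed
  have prod: "gauss_sum \<psi> (\<beta> \<otimes>\<^bsub>\<X>\<^esub> \<nu>) * gauss_sum \<psi> (inv\<^bsub>\<X>\<^esub> \<nu>) * \<nu> (- t) =
      (\<Sum>s\<in>UNIV. \<Sum>r\<in>UNIV. \<psi> (s + r) * \<beta> s * \<nu> (- (s * t / r)))"
    if \<nu>: "\<nu> \<in> ?X" for \<nu>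
  proof -
    have "\<nu> s * inverse (\<nu> r) * \<nu> (- t) = \<nu> (- (s * t / r))" for s r
    proof -
      have "- (s * t / r) = s * inverse r * - t" by (simp add: divide_inverse mult_ac)
      then show ?thesis by (simp only: char_inverse[OF \<nu>] char_mult[OF \<nu>])
    qed
    then have *: "\<psi> s * (\<beta> s * \<nu> s) * (\<psi> r * inverse (\<nu> r)) * \<nu> (- t) =
        \<psi> (s + r) * \<beta> s * \<nu> (- (s * t / r))" for s r
      unfolding add by (metis (no_types, lifting) mult.assoc mult.left_commute)
    have "gauss_sum \<psi> (\<beta> \<otimes>\<^bsub>\<X>\<^esub> \<nu>) * gauss_sum \<psi> (inv\<^bsub>\<X>\<^esub> \<nu>) =
        (\<Sum>s\<in>UNIV. \<Sum>r\<in>UNIV. \<psi> s * (\<beta> s * \<nu> s) * (\<psi> r * inverse (\<nu> r)))"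
      unfolding gauss_sum_UNIV[OF mult_char_closed[OF \<beta> \<nu>]] gauss_sum_UNIV[OF inv_char_closed[OF \<nu>]]
        minus_mult_minus sum_product mult_char_apply inv_char_apply[OF \<nu>] ..
    then show ?thesis by (simp only: sum_distrib_right *)
  qed
  have orth: "(\<Sum>\<nu>\<in>?X. \<nu> (- (s * t / r))) = (if s \<noteq> 0 \<and> r = - (s * t) then ?q - 1 else 0)"
    for s r :: 'k
  proof -
    have "- (s * t / r) = 1 \<longleftrightarrow> s \<noteq> 0 \<and> r = - (s * t)"
      using \<open>t \<noteq> 0\<close> by (cases "r = 0") (auto simp: field_simps)
    then show ?thesis by (simp only: sum_char_group)
  qed
  have "(\<Sum>\<nu>\<in>?X. poch \<psi> \<beta> \<nu> / poch0 \<psi> \<one>\<^bsub>\<X>\<^esub> \<nu> * \<nu> t) =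
      (\<Sum>\<nu>\<in>?X. (\<Sum>s\<in>UNIV. \<Sum>r\<in>UNIV. \<psi> (s + r) * \<beta> s * \<nu> (- (s * t / r)))) / gauss_sum \<psi> \<beta>"
    by (subst sum_divide_distrib, rule sum.cong[OF refl]) (simp only: coeff prod)
  also have "(\<Sum>\<nu>\<in>?X. (\<Sum>s\<in>UNIV. \<Sum>r\<in>UNIV. \<psi> (s + r) * \<beta> s * \<nu> (- (s * t / r)))) =
      (\<Sum>s\<in>UNIV. \<Sum>r\<in>UNIV. \<Sum>\<nu>\<in>?X. \<psi> (s + r) * \<beta> s * \<nu> (- (s * t / r)))"
    by (subst sum.swap) (rule sum.cong[OF refl], rule sum.swap)
  also have "\<dots> = (\<Sum>s\<in>UNIV. \<Sum>r\<in>UNIV. if r = - (s * t) then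
      (if s = 0 then 0 else \<psi> (s + r) * \<beta> s * (?q - 1)) else 0)"
    unfolding sum_distrib_left[symmetric] orth by (intro sum.cong refl) auto
  also have "\<dots> = (\<Sum>s\<in>UNIV. (?q - 1) * (\<psi> (s * (1 - t)) * \<beta> s))"
    by (rule sum.cong[OF refl]) (simp add: char_zero[OF \<beta>] right_diff_distrib mult_ac)
  also have "\<dots> = (1 - ?q) * inverse (\<beta> (1 - t)) * gauss_sum \<psi> \<beta>"
    unfolding sum_distrib_left[symmetric] gauss_sum_scale[OF \<beta> assms(3) \<psi>]
    by (simp add: algebra_simps)
  finally show ?thesis using g\<beta> by simp
qed

section \<open>The integral representation\<close>

text \<open>
  Expand every factor \<open>\<beta>\<^sub>i\<^sup>-\<^sup>1(1 - \<lambda>\<^sub>i x)\<close> by the binomial theorem and interchange the sums.  For a family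
  \<open>\<nu>\<close> of characters with product \<open>N \<nu>\<close>, the sum over \<open>x\<close> becomes \<open>- j(\<alpha> N \<nu>, \<chi>)\<close>, which is a multiple
  of \<open>j(\<alpha>, \<chi>)\<close>.
\<close>
lemma lauricella_FD_integral:
  fixes \<psi> \<alpha> \<chi> :: "'k :: {field, finite} \<Rightarrow> qbar" and \<beta> :: "nat \<Rightarrow> 'k \<Rightarrow> qbar"
    and lam :: "nat \<Rightarrow> 'k"
  assumes \<psi>: "nontrivial_add_char \<psi>" and \<alpha>: "\<alpha> \<in> carrier \<X>"
    and \<chi>: "\<chi> \<in> carrier \<X>" "\<chi> \<noteq> \<one>\<^bsub>\<X>\<^esub>"
    and \<beta>: "\<And>i. i \<in> {1..n} \<Longrightarrow> \<beta> i \<in> carrier \<X>" "\<And>i. i \<in> {1..n} \<Longrightarrow> \<beta> i \<noteq> \<one>\<^bsub>\<X>\<^esub>"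
    and lam: "\<And>i. i \<in> {1..n} \<Longrightarrow> lam i \<noteq> 0"
  shows "jacobi_sum [\<alpha>, \<chi>] * lauricella_FD \<psi> n \<alpha> \<beta> (\<alpha> \<otimes>\<^bsub>\<X>\<^esub> \<chi>) lam =
    - (\<Sum>x\<in>UNIV. \<alpha> x * \<chi> (1 - x) * (\<Prod>i=1..n. inverse (\<beta> i (1 - lam i * x))))"
proof -
  let ?X = "carrier (\<X> :: ('k \<Rightarrow> qbar) monoid)" and ?q = "of_nat CARD('k) :: qbar"
  let ?P = "{1..n} \<rightarrow>\<^sub>E ?X" and ?\<gamma> = "\<alpha> \<otimes>\<^bsub>\<X>\<^esub> \<chi>"
  define N where "N \<nu> = finprod \<X> \<nu> {1..n}" for \<nu> :: "nat \<Rightarrow> 'k \<Rightarrow> qbar"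
  define C where "C i \<nu> = poch \<psi> (\<beta> i) \<nu> / poch0 \<psi> \<one>\<^bsub>\<X>\<^esub> \<nu>" for i \<nu>
  have "CARD('k) \<noteq> 1" using card_field_ge_2[where 'k = 'k] by simp
  then have q: "1 - ?q \<noteq> 0" by (metis eq_iff_diff_eq_0 of_nat_1 of_nat_eq_iff)
  have P: "\<nu> i \<in> ?X" if "\<nu> \<in> ?P" "i \<in> {1..n}" for \<nu> i using that by auto
  have N: "N \<nu> \<in> ?X" if "\<nu> \<in> ?P" for \<nu>
    unfolding N_def using P[OF that]
    by (intro comm_monoid.finprod_closed[OF comm_group.axioms(1)[OF comm_group_mult_char_group]]) auto
  have expand: "\<alpha> x * \<chi> (1 - x) * (\<Prod>i=1..n. inverse (\<beta> i (1 - lam i * x))) =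
      1 / (1 - ?q) ^ n * (\<Sum>\<nu>\<in>?P. (\<Prod>i=1..n. C i (\<nu> i) * \<nu> i (lam i)) *
        ((\<alpha> \<otimes>\<^bsub>\<X>\<^esub> N \<nu>) x * \<chi> (1 - x)))" for x
  proof (cases "x = 0")
    case True
    \<comment> \<open>The binomial theorem does not apply at \<open>x = 0\<close>, but the factor \<open>\<alpha>(0) = 0\<close> makes
      both sides vanish.\<close>
    then show ?thesis by (simp add: char_zero[OF \<alpha>] mult_char_apply)
  next
    case False
    have "(\<Prod>i=1..n. inverse (\<beta> i (1 - lam i * x))) =
        (\<Prod>i=1..n. 1 / (1 - ?q) * (\<Sum>\<nu>\<in>?X. C i \<nu> * \<nu> (lam i * x)))"
    proof (rule prod.cong[OF refl])
      fix i assume i: "i \<in> {1..n}"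
      have "lam i * x \<noteq> 0" using lam[OF i] False by simp
      from binomial_theorem_char[OF \<psi> \<beta>(1)[OF i] \<beta>(2)[OF i] this]
      show "inverse (\<beta> i (1 - lam i * x)) = 1 / (1 - ?q) * (\<Sum>\<nu>\<in>?X. C i \<nu> * \<nu> (lam i * x))"
        unfolding C_def using q by simp
    qed
    also have "\<dots> = 1 / (1 - ?q) ^ n * (\<Prod>i=1..n. \<Sum>\<nu>\<in>?X. C i \<nu> * \<nu> (lam i * x))"
      by (simp add: prod_dividef)
    also have "(\<Prod>i=1..n. \<Sum>\<nu>\<in>?X. C i \<nu> * \<nu> (lam i * x)) =
        (\<Sum>\<nu>\<in>?P. \<Prod>i=1..n. C i (\<nu> i) * \<nu> i (lam i * x))"
      by (rule prod_sum_PiE) simp_all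
    also have "\<dots> = (\<Sum>\<nu>\<in>?P. (\<Prod>i=1..n. C i (\<nu> i) * \<nu> i (lam i)) * N \<nu> x)"
    proof (rule sum.cong[OF refl])
      fix \<nu> assume \<nu>: "\<nu> \<in> ?P"
      have "N \<nu> x = (\<Prod>i=1..n. \<nu> i x)"
        unfolding N_def by (rule finprod_char_apply[OF _ P[OF \<nu>] False]) simp_all
      moreover have "(\<Prod>i=1..n. C i (\<nu> i) * \<nu> i (lam i * x)) = (\<Prod>i=1..n. C i (\<nu> i) * \<nu> i (lam i) * \<nu> i x)"
        by (rule prod.cong[OF refl]) (simp only: char_mult[OF P[OF \<nu>]] mult.assoc)
      ultimately show "(\<Prod>i=1..n. C i (\<nu> i) * \<nu> i (lam i * x)) =
          (\<Prod>i=1..n. C i (\<nu> i) * \<nu> i (lam i)) * N \<nu> x"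
        by (simp only: prod.distrib)
    qed
    finally show ?thesis
      by (simp add: sum_distrib_left mult_char_apply mult_ac)
  qed
  have inner: "(\<Sum>x\<in>UNIV. (\<alpha> \<otimes>\<^bsub>\<X>\<^esub> N \<nu>) x * \<chi> (1 - x)) =
      - jacobi_sum [\<alpha>, \<chi>] * (poch \<psi> \<alpha> (N \<nu>) / poch0 \<psi> ?\<gamma> (N \<nu>))" if "\<nu> \<in> ?P" for \<nu>
  proof -
    have "(\<Sum>x\<in>UNIV. (\<alpha> \<otimes>\<^bsub>\<X>\<^esub> N \<nu>) x * \<chi> (1 - x)) = - jacobi_sum [\<alpha> \<otimes>\<^bsub>\<X>\<^esub> N \<nu>, \<chi>]"
      by (simp add: jacobi_sum_pair[OF mult_char_closed[OF \<alpha> N[OF that]] \<chi>(1)])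
    then show ?thesis
      by (simp only: jacobi_sum_mult_char[OF \<psi> \<alpha> \<chi>(1) N[OF that] \<chi>(2)] mult_minus_left)
  qed
  have "(\<Sum>x\<in>UNIV. \<alpha> x * \<chi> (1 - x) * (\<Prod>i=1..n. inverse (\<beta> i (1 - lam i * x)))) =
      1 / (1 - ?q) ^ n * (\<Sum>\<nu>\<in>?P. (\<Prod>i=1..n. C i (\<nu> i) * \<nu> i (lam i)) *
        (\<Sum>x\<in>UNIV. (\<alpha> \<otimes>\<^bsub>\<X>\<^esub> N \<nu>) x * \<chi> (1 - x)))"
    unfolding expand sum_distrib_left[symmetric]
    by (rule arg_cong[where f = "\<lambda>u. 1 / (1 - ?q) ^ n * u"], subst sum.swap) (simp only: sum_distrib_left)
  also have "\<dots> = 1 / (1 - ?q) ^ n * (\<Sum>\<nu>\<in>?P. - jacobi_sum [\<alpha>, \<chi>] *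
      ((poch \<psi> \<alpha> (N \<nu>) * (\<Prod>i=1..n. poch \<psi> (\<beta> i) (\<nu> i))) /
        (poch0 \<psi> ?\<gamma> (N \<nu>) * (\<Prod>i=1..n. poch0 \<psi> \<one>\<^bsub>\<X>\<^esub> (\<nu> i))) *
        (\<Prod>i=1..n. \<nu> i (lam i))))"
    by (rule arg_cong[where f = "\<lambda>u. 1 / (1 - ?q) ^ n * u"], rule sum.cong[OF refl])
      (simp only: inner C_def prod.distrib prod_dividef, simp add: mult_ac)
  also have "\<dots> = - (jacobi_sum [\<alpha>, \<chi>] * lauricella_FD \<psi> n \<alpha> \<beta> ?\<gamma> lam)"
    unfolding lauricella_FD_def N_def[symmetric] sum_distrib_left[symmetric] by simp
  finally show ?thesis by simp
qed

section \<open>Point counts\<close>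

text \<open>
  For \<open>t \<noteq> 0\<close> every \<open>y\<close> with \<open>y^d = t\<close> satisfies \<open>y^(q-1) = t^((q-1)/d)\<close>, so the second condition holds
  either for all \<open>d\<close> roots or for none.
\<close>
lemma card_superelliptic_fibre:
  fixes t \<xi> :: "'k :: {field, finite}"
  assumes d: "d dvd CARD('k) - 1"
  shows "card {y. y ^ d = to_ac t \<and> y ^ CARD('k) = to_ac \<xi> * y} =
    (if t = 0 then 1 else if t ^ ((CARD('k) - 1) div d) = \<xi> then d else 0)"
proof -
  define e where "e = (CARD('k) - 1) div d"
  have de: "CARD('k) - 1 = d * e" using d by (simp add: e_def)
  have q: "CARD('k) \<ge> 2" by (rule card_field_ge_2)
  have "d > 0" using de q by (cases d) auto
  show ?thesis
  proof (cases "t = 0")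
    case True
    have "{y. y ^ d = to_ac t \<and> y ^ CARD('k) = to_ac \<xi> * y} = {0}"
      using \<open>d > 0\<close> q by (auto simp: True power_0_left)
    then show ?thesis using True by simp
  next
    case False
    have *: "y ^ CARD('k) = to_ac \<xi> * y \<longleftrightarrow> t ^ e = \<xi>" if y: "y ^ d = to_ac t" for y
    proof -
      have "y \<noteq> 0" using y False \<open>d > 0\<close> by (auto simp: power_0_left)
      have "y ^ CARD('k) = y ^ (CARD('k) - 1) * y"
        using q by (metis Suc_diff_1 less_le_trans pos2 power_Suc2)
      also have "y ^ (CARD('k) - 1) = to_ac (t ^ e)"
        by (simp only: de power_mult y to_ac_power)
      finally show ?thesis using \<open>y \<noteq> 0\<close> by (simp only: mult_cancel_right to_ac_eq_iff simp_thms)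
    qed
    have "of_nat d \<noteq> (0 :: 'k alg_closure)"
      using of_nat_dvd_card_minus_1[OF d] by (metis to_ac_eq_0_iff to_ac_of_nat)
    then have "card {y. y ^ d = to_ac t} = d"
      using False by (intro card_nth_roots_alg_closed) simp_all
    moreover have "{y. y ^ d = to_ac t \<and> y ^ CARD('k) = to_ac \<xi> * y} =
        (if t ^ e = \<xi> then {y. y ^ d = to_ac t} else {})"
      using * by auto
    ultimately show ?thesis using False by (simp add: e_def)
  qed
qed

text \<open>
  Count fibrewise over \<open>x \<in> \<kappa>\<close>.  Over a zero of \<open>f\<close> the single point \<open>y = 0\<close> is counted for every \<open>\<xi>\<close>, which
  gives the mean of \<open>\<theta>\<close>; over any other \<open>x\<close> only \<open>\<xi> = f(x)^((q-1)/d)\<close> occurs, with \<open>d\<close> points that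
  cancel the order of \<open>\<mu>\<^sub>d\<close>.
\<close>
lemma twisted_count_superelliptic:
  fixes f :: "'k :: {field, finite} \<Rightarrow> 'k" and P :: "'k alg_closure \<Rightarrow> 'k alg_closure"
  assumes d: "d dvd CARD('k) - 1" and P: "\<And>x. P (to_ac x) = to_ac (f x)"
  shows "twisted_count {(x, y). y ^ d = P x} frob_plane (mu d) mu_act 1 \<theta> =
    (\<Sum>x\<in>UNIV. if f x = 0 then (\<Sum>\<xi>\<in>mu d. \<theta> \<xi>) / of_nat d else \<theta> (f x ^ ((CARD('k) - 1) div d)))"
proof -
  define e where "e = (CARD('k) - 1) div d"
  have de: "CARD('k) - 1 = d * e" using d by (simp add: e_def)
  have "d > 0" using de card_field_ge_2[where 'k = 'k] by (cases d) auto
  have count: "card {p \<in> {(x, y). y ^ d = P x}. (frob_plane ^^ 1) p = mu_act \<xi> p} =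
      (\<Sum>x\<in>UNIV. if f x = 0 then 1 else if f x ^ e = \<xi> then d else 0)" for \<xi> :: 'k
  proof -
    let ?Y = "\<lambda>x. {y. y ^ d = to_ac (f x) \<and> y ^ CARD('k) = to_ac \<xi> * y}"
    have "{p \<in> {(x, y). y ^ d = P x}. (frob_plane ^^ 1) p = mu_act \<xi> p} =
        (\<lambda>(x, y). (to_ac x, y)) ` (SIGMA x:UNIV. ?Y x)"
      by (auto simp: frob_plane_def mu_act_def fixed_by_frobenius_iff P image_iff finite_field_power_card
          simp flip: to_ac_power)
    moreover have "inj (\<lambda>(x :: 'k, y :: 'k alg_closure). (to_ac x, y))"
      by (auto intro!: injI)
    moreover have "finite (?Y x)" for x
      using finite_nth_roots_idom[OF \<open>d > 0\<close>, of "to_ac (f x)"] by (rule rev_finite_subset) auto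
    ultimately show ?thesis
      by (simp add: card_image inj_on_subset card_SigmaI card_superelliptic_fibre[OF d, folded e_def])
  qed
  have "f x ^ e \<in> mu d" if "f x \<noteq> 0" for x
    using finite_field_power_card_minus_1[OF that] de
    by (simp add: mu_def mult.commute flip: power_mult)
  then have fibre: "(\<Sum>\<xi>\<in>mu d. \<theta> \<xi> * of_nat (if f x = 0 then 1 else if f x ^ e = \<xi> then d else 0)) =
      of_nat d * (if f x = 0 then (\<Sum>\<xi>\<in>mu d. \<theta> \<xi>) / of_nat d else \<theta> (f x ^ e))" for x
    using \<open>d > 0\<close> by (auto simp: if_distrib[of of_nat] if_distrib[of "\<lambda>u. _ * u"] sum.delta' cong: if_cong)
  have "(\<Sum>\<xi>\<in>mu d. \<theta> \<xi> * of_nat (\<Sum>x\<in>UNIV. if f x = 0 then 1 else if f x ^ e = \<xi> then d else 0)) =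
      (\<Sum>x\<in>UNIV. \<Sum>\<xi>\<in>mu d. \<theta> \<xi> * of_nat (if f x = 0 then 1 else if f x ^ e = \<xi> then d else 0))"
    unfolding of_nat_sum sum_distrib_left by (rule sum.swap)
  also have "\<dots> = of_nat d *
      (\<Sum>x\<in>UNIV. if f x = 0 then (\<Sum>\<xi>\<in>mu d. \<theta> \<xi>) / of_nat d else \<theta> (f x ^ e))"
    by (simp only: fibre sum_distrib_left)
  finally show ?thesis
    unfolding twisted_count_def count card_mu[OF d] e_def[symmetric] using \<open>d > 0\<close> by simp
qed

text \<open>
  If \<open>d\<close> does not divide \<open>m\<close>, then \<open>\<phi>\<^sub>d^m\<close> is nontrivial, say different from 1 at \<open>x\<close>; hence \<open>\<chi>^m\<close> is
  different from 1 at the \<open>d\<close>th root of unity \<open>\<zeta> = x^((q-1)/d)\<close>, and multiplication by \<open>\<zeta>\<close> shows that the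
  sum vanishes.
\<close>
lemma sum_char_mu:
  fixes \<phi> :: "'k :: {field, finite} \<Rightarrow> qbar" and m :: int
  assumes \<phi>: "\<phi> \<in> carrier \<X>" "generate \<X> {\<phi>} = carrier \<X>" and d: "d dvd CARD('k) - 1"
  shows "(\<Sum>\<xi>\<in>mu d. char_mu \<phi> d \<xi> powi m) = (if int d dvd m then of_nat d else 0)"
proof -
  define e where "e = (CARD('k) - 1) div d"
  have de: "CARD('k) - 1 = d * e" using d by (simp add: e_def)
  have "d > 0" using de card_field_ge_2[where 'k = 'k] by (cases d) auto
  then have mu0: "\<xi> \<noteq> 0" if "\<xi> \<in> mu d" for \<xi> :: 'k using that by (auto simp: mu_def power_0_left)
  have sum: "(\<Sum>\<xi>\<in>mu d. char_mu \<phi> d \<xi> powi m) = (\<Sum>\<xi>\<in>mu d. \<phi> \<xi> powi m)"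
    by (rule sum.cong[OF refl]) (simp add: char_mu_def)
  show ?thesis
  proof (cases "int d dvd m")
    case True
    then obtain k where k: "m = int d * k" by blast
    have "\<phi> \<xi> powi m = 1" if "\<xi> \<in> mu d" for \<xi>
    proof -
      have "\<phi> \<xi> ^ d = 1"
        using that by (simp add: mu_def char_one[OF \<phi>(1)] flip: char_power[OF \<phi>(1)])
      then show ?thesis by (simp add: k power_int_mult)
    qed
    then show ?thesis using True by (simp add: sum card_mu[OF d])
  next
    case False
    then obtain x where x: "(char_root \<phi> d [^]\<^bsub>\<X>\<^esub> m) x \<noteq> \<one>\<^bsub>\<X>\<^esub> x"
      using char_root_int_pow_eq_one_iff[OF \<phi> d, of m] by (metis ext)
    have cl: "char_root \<phi> d [^]\<^bsub>\<X>\<^esub> m \<in> carrier \<X>"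
      by (rule group.int_pow_closed[OF group_char char_root_closed[OF \<phi>(1)]])
    have x0: "x \<noteq> 0" using x char_zero[OF cl] by (auto simp: one_char_apply)
    define \<zeta> where "\<zeta> = x ^ e"
    have \<zeta>: "\<zeta> \<in> mu d"
      using finite_field_power_card_minus_1[OF x0] de
      by (simp add: \<zeta>_def mu_def mult.commute flip: power_mult)
    have "\<phi> \<zeta> powi m \<noteq> 1"
      using x x0 by (simp add: int_pow_char_apply[OF char_root_closed[OF \<phi>(1)] x0]
          char_root_apply[OF \<phi>(1) x0] one_char_apply \<zeta>_def e_def)
    moreover have "\<phi> \<zeta> powi m * (\<Sum>\<xi>\<in>mu d. \<phi> \<xi> powi m) = (\<Sum>\<xi>\<in>mu d. \<phi> (\<zeta> * \<xi>) powi m)"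
      by (simp add: sum_distrib_left char_mult[OF \<phi>(1)] power_int_mult_distrib)
    moreover have "(\<Sum>\<xi>\<in>mu d. \<phi> (\<zeta> * \<xi>) powi m) = (\<Sum>\<xi>\<in>mu d. \<phi> \<xi> powi m)"
      by (rule sum.reindex_bij_witness[of _ "\<lambda>\<xi>. \<xi> / \<zeta>" "\<lambda>\<xi>. \<zeta> * \<xi>"])
        (use \<zeta> mu0[OF \<zeta>] in \<open>auto simp: mu_def power_mult_distrib power_divide\<close>)
    ultimately show ?thesis using False by (simp add: sum)
  qed
qed

theorem theorem4p2:
  fixes \<psi> \<phi> :: "'k :: {field, finite} \<Rightarrow> qbar"
    and n d a c :: nat
    and b :: "nat \<Rightarrow> nat"
    and lam :: "nat \<Rightarrow> 'k"
    and m :: int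
  assumes "nontrivial_add_char \<psi>"
    and "\<phi> \<in> carrier \<X>" and "generate \<X> {\<phi>} = carrier \<X>"
    and "n \<ge> 1"
    and "d > 0" and "a > 0" and "c > 0" and "\<And>i. i \<in> {1..n} \<Longrightarrow> b i > 0"
    and "d dvd CARD('k) - 1"
    and "\<And>i. i \<in> {1..n} \<Longrightarrow> lam i \<noteq> 0" and "\<And>i. i \<in> {1..n} \<Longrightarrow> lam i \<noteq> 1"
    and "inj_on lam {1..n}"
    and "gcd d c = 1" and "\<And>i. i \<in> {1..n} \<Longrightarrow> gcd d (b i) = 1"
  shows "twisted_count (curve_CD n d a b c lam) frob_plane (mu d) mu_act 1 (\<lambda>\<xi>. char_mu \<phi> d \<xi> powi m) =
    (if int d dvd m then of_nat CARD('k)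
     else - jacobi_sum [char_root \<phi> d [^]\<^bsub>\<X>\<^esub> (m * int a), char_root \<phi> d [^]\<^bsub>\<X>\<^esub> (m * int c)] *
       lauricella_FD \<psi> n
         (char_root \<phi> d [^]\<^bsub>\<X>\<^esub> (m * int a))
         (\<lambda>i. (inv\<^bsub>\<X>\<^esub> (char_root \<phi> d)) [^]\<^bsub>\<X>\<^esub> (m * int (b i)))
         (char_root \<phi> d [^]\<^bsub>\<X>\<^esub> (m * int (a + c)))
         lam)"
proof -
  interpret group "\<X> :: ('k \<Rightarrow> qbar) monoid" by (rule group_char)
  note \<phi> = assms(2,3) and d = assms(9)
  define \<rho> where "\<rho> = char_root \<phi> d"
  have \<rho>: "\<rho> \<in> carrier \<X>" unfolding \<rho>_def by (rule char_root_closed[OF \<phi>(1)])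
  define f where "f x = (\<Prod>i=1..n. (1 - lam i * x) ^ b i) * x ^ a * (1 - x) ^ c" for x
  have curve: "curve_CD n d a b c lam =
      {(x, y). y ^ d = (\<Prod>i=1..n. (1 - to_ac (lam i) * x) ^ b i) * x ^ a * (1 - x) ^ c}"
    by (rule curve_CD_def)
  have count: "twisted_count (curve_CD n d a b c lam) frob_plane (mu d) mu_act 1 (\<lambda>\<xi>. char_mu \<phi> d \<xi> powi m) =
      (\<Sum>x\<in>UNIV. if f x = 0 then (if int d dvd m then 1 else 0) else \<rho> (f x) powi m)"
  proof -
    have e: "char_mu \<phi> d (f x ^ ((CARD('k) - 1) div d)) = \<rho> (f x)" if "f x \<noteq> 0" for x
    proof -
      have "f x ^ ((CARD('k) - 1) div d) \<in> mu d"
        using finite_field_power_card_minus_1[OF that] d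
        by (simp add: mu_def flip: power_mult)
      then show ?thesis by (simp add: char_mu_def \<rho>_def char_root_apply[OF \<phi>(1) that])
    qed
    let ?P = "\<lambda>x. (\<Prod>i=1..n. (1 - to_ac (lam i) * x) ^ b i) * x ^ a * (1 - x) ^ c"
    have P: "(\<Prod>i=1..n. (1 - to_ac (lam i) * to_ac x) ^ b i) * to_ac x ^ a * (1 - to_ac x) ^ c =
        to_ac (f x)" for x
      by (simp add: f_def to_ac_prod)
    show ?thesis
      unfolding curve twisted_count_superelliptic[OF d, of ?P f, OF P] sum_char_mu[OF \<phi> d]
    proof (rule sum.cong[OF refl])
      fix x
      show "(if f x = 0 then (if int d dvd m then of_nat d else 0) / of_nat d
          else char_mu \<phi> d (f x ^ ((CARD('k) - 1) div d)) powi m) =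
        (if f x = 0 then if int d dvd m then 1 else 0 else \<rho> (f x) powi m)"
        using assms(5) e[of x] by (cases "f x = 0") simp_all
    qed
  qed
  show ?thesis
  proof (cases "int d dvd m")
    case True
    have "\<rho> y powi m = 1" if "y \<noteq> 0" for y
    proof -
      have "\<rho> [^]\<^bsub>\<X>\<^esub> m = \<one>\<^bsub>\<X>\<^esub>"
        unfolding \<rho>_def using True by (simp only: char_root_int_pow_eq_one_iff[OF \<phi> d])
      then show ?thesis
        using int_pow_char_apply[OF \<rho> that, of m] that by (simp add: one_char_apply)
    qed
    then have "(if f x = 0 then if int d dvd m then 1 else 0 else \<rho> (f x) powi m) = 1" for x
      using True by simp
    then show ?thesis unfolding count using True by simp
  next
    case False
    have nontriv: "\<not> int d dvd m * int k" if "gcd d k = 1" for k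
      using False that by (simp add: coprime_dvd_mult_left_iff coprime_iff_gcd_eq_1)
    define \<alpha> where "\<alpha> = \<rho> [^]\<^bsub>\<X>\<^esub> (m * int a)"
    define \<chi> where "\<chi> = \<rho> [^]\<^bsub>\<X>\<^esub> (m * int c)"
    define \<beta> where "\<beta> i = (inv\<^bsub>\<X>\<^esub> \<rho>) [^]\<^bsub>\<X>\<^esub> (m * int (b i))" for i
    have \<alpha>: "\<alpha> \<in> carrier \<X>" and \<chi>: "\<chi> \<in> carrier \<X>"
      unfolding \<alpha>_def \<chi>_def using \<rho> by (rule int_pow_closed)+
    have \<beta>: "\<beta> i \<in> carrier \<X>" for i
      unfolding \<beta>_def by (rule int_pow_closed[OF inv_char_closed[OF \<rho>]])
    have \<chi>1: "\<chi> \<noteq> \<one>\<^bsub>\<X>\<^esub>"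
      unfolding \<chi>_def \<rho>_def char_root_int_pow_eq_one_iff[OF \<phi> d] by (rule nontriv[OF assms(13)])
    have \<beta>1: "\<beta> i \<noteq> \<one>\<^bsub>\<X>\<^esub>" if "i \<in> {1..n}" for i
    proof -
      have "\<beta> i = \<rho> [^]\<^bsub>\<X>\<^esub> (- (m * int (b i)))"
        unfolding \<beta>_def by (simp only: int_pow_inv[OF \<rho>] int_pow_neg[OF \<rho>])
      then show ?thesis
        using nontriv[OF assms(14)[OF that]]
        unfolding \<rho>_def by (simp only: char_root_int_pow_eq_one_iff[OF \<phi> d] dvd_minus_iff not_False_eq_True)
    qed
    have \<gamma>: "\<rho> [^]\<^bsub>\<X>\<^esub> (m * int (a + c)) = \<alpha> \<otimes>\<^bsub>\<X>\<^esub> \<chi>"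
      unfolding \<alpha>_def \<chi>_def int_pow_mult[OF \<rho>, symmetric] by (simp add: distrib_left)
    have pow: "(\<rho> [^]\<^bsub>\<X>\<^esub> (m * int k)) y = \<rho> (y ^ k) powi m" if "y \<noteq> 0" for y k
      unfolding int_pow_char_apply[OF \<rho> that] char_power[OF \<rho>]
      by (simp add: power_int_power mult.commute)
    \<comment> \<open>The convention \<open>\<eta>(0) = 0\<close> makes the product on the right vanish at the zeros of \<open>f\<close>; as \<open>a\<close>, \<open>c\<close>
      and the \<open>b\<^sub>i\<close> are positive, these are exactly the points where one of its factors is 0.\<close>
    have summand: "(if f x = 0 then 0 else \<rho> (f x) powi m) =
        \<alpha> x * \<chi> (1 - x) * (\<Prod>i=1..n. inverse (\<beta> i (1 - lam i * x)))" for x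
    proof (cases "f x = 0")
      case True
      then consider "x = 0" | "1 - x = 0" | i where "i \<in> {1..n}" "1 - lam i * x = 0"
        by (auto simp: f_def)
      then have "\<alpha> x * \<chi> (1 - x) * (\<Prod>i=1..n. inverse (\<beta> i (1 - lam i * x))) = 0"
      proof cases
        case 3
        then have "inverse (\<beta> i (1 - lam i * x)) = 0" by (simp only: char_zero[OF \<beta>] inverse_zero)
        then have "(\<Prod>i=1..n. inverse (\<beta> i (1 - lam i * x))) = 0"
          using 3(1) by (intro prod_zero) auto
        then show ?thesis by simp
      qed (simp_all add: char_zero[OF \<alpha>] char_zero[OF \<chi>])
      then show ?thesis using True by simp
    next
      case fx: False
      have x: "x \<noteq> 0" "1 - x \<noteq> 0"
        using fx assms(6,7) by (auto simp: f_def power_0_left)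
      have lx: "1 - lam i * x \<noteq> 0" if "i \<in> {1..n}" for i
        using fx that assms(8)[OF that] by (auto simp: f_def)
      have \<beta>x: "inverse (\<beta> i (1 - lam i * x)) = \<rho> ((1 - lam i * x) ^ b i) powi m" if "i \<in> {1..n}" for i
        unfolding \<beta>_def int_pow_inv[OF \<rho>] inv_char_apply[OF int_pow_closed[OF \<rho>]]
        by (simp only: inverse_inverse_eq pow[OF lx[OF that]])
      have "\<rho> (f x) = (\<Prod>i=1..n. \<rho> ((1 - lam i * x) ^ b i)) * \<rho> (x ^ a) * \<rho> ((1 - x) ^ c)"
        unfolding f_def char_mult[OF \<rho>] char_prod[OF \<rho>] ..
      then have "\<rho> (f x) powi m =
          (\<Prod>i=1..n. \<rho> ((1 - lam i * x) ^ b i) powi m) * \<rho> (x ^ a) powi m * \<rho> ((1 - x) ^ c) powi m"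
        by (simp only: power_int_mult_distrib power_int_prod)
      also have "\<dots> = (\<Prod>i=1..n. inverse (\<beta> i (1 - lam i * x))) * \<alpha> x * \<chi> (1 - x)"
        unfolding \<alpha>_def \<chi>_def pow[OF x(1)] pow[OF x(2)] by (simp add: \<beta>x)
      finally show ?thesis using fx by (simp add: mult_ac)
    qed
    have "jacobi_sum [\<alpha>, \<chi>] * lauricella_FD \<psi> n \<alpha> \<beta> (\<alpha> \<otimes>\<^bsub>\<X>\<^esub> \<chi>) lam =
        - (\<Sum>x\<in>UNIV. \<alpha> x * \<chi> (1 - x) * (\<Prod>i=1..n. inverse (\<beta> i (1 - lam i * x))))"
      by (rule lauricella_FD_integral[OF assms(1) \<alpha> \<chi> \<chi>1]) (rule \<beta>, erule \<beta>1, erule assms(10))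
    then have "(\<Sum>x\<in>UNIV. if f x = 0 then 0 else \<rho> (f x) powi m) =
        - (jacobi_sum [\<alpha>, \<chi>] * lauricella_FD \<psi> n \<alpha> \<beta> (\<alpha> \<otimes>\<^bsub>\<X>\<^esub> \<chi>) lam)"
      by (simp only: summand minus_minus)
    then show ?thesis
      unfolding count \<rho>_def[symmetric] \<gamma> \<alpha>_def[symmetric] \<chi>_def[symmetric] \<beta>_def[symmetric]
      using False by simp
  qed
qed

end
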